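(* Let $\{(x^k,w^k)\}_{k\in\mathbb N}$ be an infinite sequence generated by algorithm PPSNA (described in the context), where the inner solver SNA is stopped with criteria (C1), (C2) and (C3), i.e. for every $k$, $(x^{k+1},w^{k+1})$ satisfies $$\text{(C1)}\ \ \Xi_k(w^{k+1})-\Xi_k(\tilde w^k)\le\frac1{4\gamma_k}\|w^{k+1}-w^k\|_M^2,$$ $$\text{(C2)}\ \ G_k(x^{k+1},w^{k+1})\le\frac{\varepsilon_k^2}{2\gamma_k},\ \ \varepsilon_k\ge0,\ \sum_{k=0}^\infty\varepsilon_k<\infty,$$ $$\text{(C3)}\ \ G_k(x^{k+1},w^{k+1})\le\frac{\eta_k^2}{2\gamma_k}\|w^{k+1}-w^k\|_M^2,\ \ 0\le\eta_k<1,\ \sum_{k=0}^\infty\eta_k<\infty .$$ Suppose that: (1) $f$ is coercive: $\liminf_{\|x\|\to\infty}f(x)/\|x\|=\infty$; (2) $\{w^k\}_{k\in\mathbb N}$ is bounded, and $g^*$ is continuous on its domain, i.e. $g^*(y^\nu)\to g^*(\bar y)$ whenever $\bar y,y^\nu\in\operatorname{dom}g^*$ and $y^\nu\to\bar y$; (3) the set $\{x: x\in\operatorname{ri}(\operatorname{dom}f),\ Ax\in\operatorname{ri}(\operatorname{dom}g),\ (Bx)_{T_\infty}=0\}$ is nonempty, where $T_\infty$ is the eventual value of the index sets $T_k$ (under (1), (2), (C1), (C2) one has $T_k=T_\infty$ for all sufficiently large $k$), and where "$\operatorname{ri}$" can be omitted for $f$ (resp. $g$) if $f$ (resp. $g$)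 is polyhedral convex; (4) for any $\nu_1>0$ there exists $\zeta_1>0$ such that $\operatorname{dist}(w,\mathcal S^{-1}(0))\le\zeta_1\operatorname{dist}(0,\mathcal S(w))$ whenever $\operatorname{dist}(w,\mathcal S^{-1}(0))\le\nu_1$, where $\mathcal S$ is the multifunction defined in the context. Then there is a constant $\zeta_1>0$ (an error-bound constant provided by (4) for a suitable $\nu_1>0$) such that for all sufficiently large $k$, $$\operatorname{dist}_M(w^{k+1},\mathcal S^{-1}(0))\le\rho_k\operatorname{dist}_M(w^k,\mathcal S^{-1}(0)),$$ where $$\rho_k=(1-\eta_k)^{-1}\left(\eta_k+(1+\eta_k)\frac{\zeta_1\lambda_{\max}(M)}{\sqrt{\gamma_k^2+\zeta_1^2\lambda_{\max}^2(M)}}\right)$$ and $$\limsup_{k\to\infty}\rho_k=\frac{\zeta_1\lambda_{\max}(M)}{\sqrt{\gamma_\infty^2+\zeta_1^2\lambda_{\max}^2(M)}}<1 .$$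
   Context: **Data.** $f:\mathbb R^n\to(-\infty,\infty]$ and $g:\mathbb R^m\to(-\infty,\infty]$ are proper, closed, convex; $A:\mathbb R^n\to\mathbb R^m$ and $B:\mathbb R^n\to\mathbb R^p$ are linear (identified with matrices); $Qx:=[Ax;Bx]\in\mathbb R^{m+p}$; $M:=QQ^\top+I$, with largest eigenvalue $\lambda_{\max}(M)$; $\|w\|_M^2:=\langle w,Mw\rangle$. Vectors of $\mathbb R^{m+p}$ are written $w=[y;z]$ with $y\in\mathbb R^m$, $z\in\mathbb R^p$. $f^*,g^*$ are the Fenchel conjugates. $\mu\in\mathbb R^p$ has positive entries. For $T\subseteq[p]=\{1,\dots,p\}$, $\overline T=[p]\setminus T$, $z_T$ is the subvector of $z$ indexed by $T$, $B_{T:}$ the submatrix of rows indexed by $T$; $\mathcal I(z)=\{i:z_i\neq0\}$. $\operatorname{ri}$ is relative interior. $\operatorname{dist}(w,\Omega)=\inf_{u\in\Omega}\|w-u\|$, $\operatorname{dist}_M(w,\Omega)=\inf_{u\in\Omega}\|w-u\|_M$ (equal to $+\infty$ if $\Omega=\emptyset$). For $\sigma>0$ and $\psi$ proper closed convex, $\mathcal E_{\sigma\psi}(p)=\min_x\{\frac1{2\sigma}\|x-p\|^2+\psi(x)\}$ and $\mathrm{Prox}_{\sigma\psi}(p)$ is the unique minimizer. **Dual function.** $\Xi(w)=f^*(-Q^\top w)+g^*(y)$. **Multifunction $\mathcal S$.** Let $\mathcal V_\infty=\{v\in\mathbb R^p:v_{T_\infty}=0\}$. For $w=[y;z]$ with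 $z_{\overline T_\infty}=0$, $$\mathcal S(w)=\{-Q\xi+[u;v]:\ \xi\in\partial f^*(-Q^\top w),\ u\in\partial g^*(y),\ v\in\mathcal V_\infty\},$$ and $\mathcal S(w)=\emptyset$ if $z_{\overline T_\infty}\ne0$. Under the assumptions, $\mathcal S^{-1}(0)=\{w:0\in\mathcal S(w)\}$ is the solution set of $\min_{w=[y;z]}\Xi(w)$ s.t. $z_{\overline T_\infty}=0$. **Algorithm PPSNA.** Input $x^0\in\mathbb R^n$, $w^0=[y^0;z^0]$ with $y^0\in\operatorname{dom}g^*$, and $\gamma_0>0$. The parameters satisfy $\gamma_k\uparrow\gamma_\infty<\infty$ (nondecreasing). For $k=0,1,\dots$, with $\Xi_k(w)=\Xi(w)+\frac1{2\gamma_k}\|w-w^k\|_M^2$: 1. (Coordinate minimization) Successively for $i=1,\dots,p$ choose $\tilde z_i^k\in\operatorname{argmin}_{t\in\mathbb R}\Xi_k(y^k,\tilde z^k_1,\dots,\tilde z^k_{i-1},t,z^k_{i+1},\dots,z^k_p)+\mu_i\mathbb 1_{\{t\ne0\}}$. Put $\tilde z^k=(\tilde z^k_1,\dots,\tilde z^k_p)$, $T_k=\mathcal I(\tilde z^k)$, $\tilde w^k=[y^k;\tilde z^k]$. 2. (Semismooth Newton) Let $(D_k)$ be the problem of minimizing $\Xi_k(w)$ subject to $z_{\overline T_k}=0$, and $(P_k)$ the problem of minimizing $\Psi_k(x)=f_k(x)+g_k(Ax)+h_k(Bx)$, where $f_k(x)=\mathcal E_{\frac1{\gamma_k}f}(x-Q^\top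 w^k/\gamma_k)-\frac1{2\gamma_k}\|Q^\top w^k\|^2$, $g_k(u)=\mathcal E_{\frac1{\gamma_k}g}(u+y^k/\gamma_k)-\frac1{2\gamma_k}\|y^k\|^2$, $h_k(v)=\frac{\gamma_k}2\|(v+z^k/\gamma_k)_{T_k}\|^2-\frac1{2\gamma_k}\|z^k\|^2$. The duality gap is $G_k(x,w)=\Psi_k(x)+\Xi_k(w)$. Run SNA (below) and let $(x^{k+1},w^{k+1})=(\bar x^j,\bar w^j)$ for an index $j$ at which the prescribed stopping criteria hold. **Inner algorithm SNA.** Parameters $\tau\in(0,1]$, $\tau_1,\tau_2,\beta\in(0,1)$, $\zeta\in(0,1/2)$; start $\bar x^0=x^k$. For $j=0,1,\dots$: choose $H_j\in\widehat\partial^2\Psi_k(\bar x^j):=\partial^2f_k(\bar x^j)+A^\top\partial^2g_k(A\bar x^j)A+\gamma_kB_{T_k:}^\top B_{T_k:}$, where $\partial^2f_k,\partial^2g_k$ are the Clarke Jacobians of $\nabla f_k,\nabla g_k$; set $\theta_j=\tau_1\|\nabla\Psi_k(\bar x^j)\|$; compute by the conjugate gradient method an approximate solution $d^j$ of $(H_j+\theta_jI)d=-\nabla\Psi_k(\bar x^j)$ with residual norm at most $\tau_2\|\nabla\Psi_k(\bar x^j)\|^{1+\tau}$; set $\bar x^{j+1}=\bar x^j+\beta^{q_j}d^j$ with $q_j$ the smallest nonnegative integer $q$ such that $\Psi_k(\bar x^j+\beta^qd^j)\le\Psi_k(\bar x^j)+\zeta\beta^q\langle\nabla\Psi_k(\bar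 x^j),d^j\rangle$. The dual iterate is $\bar w^j=[\bar y^j;\bar z^j]$ with $\bar y^j=\mathrm{Prox}_{\gamma_kg^*}(\gamma_kA\bar x^j+y^k)$, $\bar z^j_{T_k}=z^k_{T_k}+\gamma_kB_{T_k:}\bar x^j$, $\bar z^j_{\overline T_k}=0$. In particular $w^{k+1}$ is obtained from $x^{k+1}$ by these formulas. *)

theory Defs
  imports "HOL-Analysis.Analysis"
begin

section \<open>Extended-real-valued convex functions\<close>

definition edom :: "('a \<Rightarrow> ereal) \<Rightarrow> 'a set" where
  "edom \<phi> = {x. \<phi> x < \<infinity>}"

definition epi :: "('a \<Rightarrow> ereal) \<Rightarrow> ('a \<times> real) set" where
  "epi \<phi> = {(x, t). \<phi> x \<le> ereal t}"

definition proper_closed_convex :: "('a::euclidean_space \<Rightarrow> ereal) \<Rightarrow> bool" where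
  "proper_closed_convex \<phi> \<longleftrightarrow>
     (\<forall>x. \<phi> x \<noteq> -\<infinity>) \<and> edom \<phi> \<noteq> {} \<and> closed (epi \<phi>) \<and> convex (epi \<phi>)"

definition polyhedral_function :: "('a::euclidean_space \<Rightarrow> ereal) \<Rightarrow> bool" where
  "polyhedral_function \<phi> \<longleftrightarrow> polyhedron (epi \<phi>)"

definition conjugate_fun :: "('a::real_inner \<Rightarrow> ereal) \<Rightarrow> 'a \<Rightarrow> ereal" where
  "conjugate_fun \<phi> s = (SUP x. ereal (s \<bullet> x) - \<phi> x)"

definition subdifferential :: "('a::real_inner \<Rightarrow> ereal) \<Rightarrow> 'a \<Rightarrow> 'a set" where
  "subdifferential \<phi> x =
     {s. x \<in> edom \<phi> \<and> (\<forall>u. \<phi> x + ereal (s \<bullet> (u - x)) \<le> \<phi> u)}"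

text \<open>In \<^term>\<open>moreau_env \<sigma> \<psi>\<close> and \<^term>\<open>prox \<sigma> \<psi>\<close> only the
  quadratic term carries \<open>\<sigma>\<close>: they are \<open>E\<^sub>\<sigma>\<^sub>\<psi>\<close> and
  \<open>Prox\<^sub>\<sigma>\<^sub>\<psi>\<close>. For proper closed convex \<open>\<psi>\<close> and \<open>\<sigma> > 0\<close>
  the infimum is finite and attained at exactly one point.\<close>

definition prox_objective :: "real \<Rightarrow> ('a::euclidean_space \<Rightarrow> ereal) \<Rightarrow> 'a \<Rightarrow> 'a \<Rightarrow> ereal" where
  "prox_objective \<sigma> \<psi> c x = ereal (1 / (2 * \<sigma>) * (norm (x - c))\<^sup>2) + \<psi> x"

definition moreau_env :: "real \<Rightarrow> ('a::euclidean_space \<Rightarrow> ereal) \<Rightarrow> 'a \<Rightarrow> ereal" where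
  "moreau_env \<sigma> \<psi> c = (INF x. prox_objective \<sigma> \<psi> c x)"

definition prox :: "real \<Rightarrow> ('a::euclidean_space \<Rightarrow> ereal) \<Rightarrow> 'a \<Rightarrow> 'a" where
  "prox \<sigma> \<psi> c = (THE x. is_arg_min (prox_objective \<sigma> \<psi> c) (\<lambda>_. True) x)"

text \<open>\<^term>\<open>infdist\<close> would give distance \<open>0\<close> to the empty set; here it is \<open>\<infinity>\<close>.\<close>

definition edist_set :: "'a::real_normed_vector \<Rightarrow> 'a set \<Rightarrow> ereal" where
  "edist_set w \<Omega> = (INF u\<in>\<Omega>. ereal (norm (w - u)))"


section \<open>Gradients and Clarke Jacobians\<close>

definition gradient :: "('a::real_inner \<Rightarrow> real) \<Rightarrow> 'a \<Rightarrow> 'a" where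
  "gradient \<phi> x = (THE D. GDERIV \<phi> x :> D)"

definition clarke_jacobian :: "(real^'a \<Rightarrow> real^'b) \<Rightarrow> real^'a \<Rightarrow> (real^'a^'b) set" where
  "clarke_jacobian F x = convex hull
     {V. \<exists>X. X \<longlonglongrightarrow> x \<and> (\<forall>i. F differentiable (at (X i))) \<and>
             (\<lambda>i. matrix (frechet_derivative F (at (X i)))) \<longlonglongrightarrow> V}"


section \<open>Block structure\<close>

text \<open>The space of vectors \<open>w = [y; z]\<close> is the Euclidean product
  \<open>(real^'m) \<times> (real^'p)\<close>, so \<open>y = fst w\<close> and \<open>z = snd w\<close>, and its inner
  product is the sum of the two inner products. The matrix \<open>Q = [A; B]\<close> is the linear
  map \<^term>\<open>Q_map A B\<close>, its transpose the library adjoint.\<close>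

definition Q_map :: "real^'n^'m \<Rightarrow> real^'n^'p \<Rightarrow> real^'n \<Rightarrow> (real^'m) \<times> (real^'p)" where
  "Q_map A B x = (A *v x, B *v x)"

definition M_map ::
  "real^'n^'m \<Rightarrow> real^'n^'p \<Rightarrow> (real^'m) \<times> (real^'p) \<Rightarrow> (real^'m) \<times> (real^'p)" where
  "M_map A B w = Q_map A B (adjoint (Q_map A B) w) + w"

definition normM :: "real^'n^'m \<Rightarrow> real^'n^'p \<Rightarrow> (real^'m) \<times> (real^'p) \<Rightarrow> real" where
  "normM A B w = sqrt (w \<bullet> M_map A B w)"

definition distM_set ::
  "real^'n^'m \<Rightarrow> real^'n^'p \<Rightarrow> (real^'m) \<times> (real^'p) \<Rightarrow> ((real^'m) \<times> (real^'p)) set \<Rightarrow> ereal" where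
  "distM_set A B w \<Omega> = (INF u\<in>\<Omega>. ereal (normM A B (w - u)))"

definition max_eigenvalue :: "('a::real_vector \<Rightarrow> 'a) \<Rightarrow> real" where
  "max_eigenvalue L = (GREATEST l. \<exists>v. v \<noteq> 0 \<and> L v = l *\<^sub>R v)"

text \<open>Subvectors \<open>z\<^sub>T\<close> and row submatrices \<open>B\<^sub>T\<^sub>:\<close> are kept in full size, padded
  with zeros; this changes neither norms nor the product of \<open>B\<^sub>T\<^sub>:\<close> with its transpose.\<close>

definition vec_part :: "'p set \<Rightarrow> real^'p \<Rightarrow> real^'p" where
  "vec_part T z = (\<chi> i. if i \<in> T then z $ i else 0)"

definition row_part :: "'p set \<Rightarrow> real^'n^'p \<Rightarrow> real^'n^'p" where
  "row_part T B = (\<chi> i. if i \<in> T then B $ i else 0)"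

definition index_supp :: "real^'p \<Rightarrow> 'p set" where
  "index_supp z = {i. z $ i \<noteq> 0}"


section \<open>Primal and dual functions\<close>

definition Xi ::
  "(real^'n \<Rightarrow> ereal) \<Rightarrow> (real^'m \<Rightarrow> ereal) \<Rightarrow> real^'n^'m \<Rightarrow> real^'n^'p \<Rightarrow>
   (real^'m) \<times> (real^'p) \<Rightarrow> ereal" where
  "Xi f g A B w = conjugate_fun f (- adjoint (Q_map A B) w) + conjugate_fun g (fst w)"

text \<open>In the following, \<open>c\<close> and \<open>wk\<close> stand for \<open>\<gamma>\<^sub>k\<close> and \<open>w\<^sup>k\<close>.\<close>

definition Xi_prox ::
  "(real^'n \<Rightarrow> ereal) \<Rightarrow> (real^'m \<Rightarrow> ereal) \<Rightarrow> real^'n^'m \<Rightarrow> real^'n^'p \<Rightarrow> real \<Rightarrow>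
   (real^'m) \<times> (real^'p) \<Rightarrow> (real^'m) \<times> (real^'p) \<Rightarrow> ereal" where
  "Xi_prox f g A B c wk w = Xi f g A B w + ereal (1 / (2 * c) * (normM A B (w - wk))\<^sup>2)"

definition f_prox ::
  "(real^'n \<Rightarrow> ereal) \<Rightarrow> real^'n^'m \<Rightarrow> real^'n^'p \<Rightarrow> real \<Rightarrow> (real^'m) \<times> (real^'p) \<Rightarrow>
   real^'n \<Rightarrow> real" where
  "f_prox f A B c wk x =
     real_of_ereal (moreau_env (1 / c) f (x - (1 / c) *\<^sub>R adjoint (Q_map A B) wk))
     - 1 / (2 * c) * (norm (adjoint (Q_map A B) wk))\<^sup>2"

definition g_prox ::
  "(real^'m \<Rightarrow> ereal) \<Rightarrow> real \<Rightarrow> real^'m \<Rightarrow> real^'m \<Rightarrow> real" where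
  "g_prox g c yk u =
     real_of_ereal (moreau_env (1 / c) g (u + (1 / c) *\<^sub>R yk)) - 1 / (2 * c) * (norm yk)\<^sup>2"

definition h_prox :: "real \<Rightarrow> 'p set \<Rightarrow> real^'p \<Rightarrow> real^'p \<Rightarrow> real" where
  "h_prox c T zk v =
     c / 2 * (norm (vec_part T (v + (1 / c) *\<^sub>R zk)))\<^sup>2 - 1 / (2 * c) * (norm zk)\<^sup>2"

definition Psi_prox ::
  "(real^'n \<Rightarrow> ereal) \<Rightarrow> (real^'m \<Rightarrow> ereal) \<Rightarrow> real^'n^'m \<Rightarrow> real^'n^'p \<Rightarrow> real \<Rightarrow> 'p set \<Rightarrow>
   (real^'m) \<times> (real^'p) \<Rightarrow> real^'n \<Rightarrow> real" where
  "Psi_prox f g A B c T wk x =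
     f_prox f A B c wk x + g_prox g c (fst wk) (A *v x) + h_prox c T (snd wk) (B *v x)"

definition duality_gap ::
  "(real^'n \<Rightarrow> ereal) \<Rightarrow> (real^'m \<Rightarrow> ereal) \<Rightarrow> real^'n^'m \<Rightarrow> real^'n^'p \<Rightarrow> real \<Rightarrow> 'p set \<Rightarrow>
   (real^'m) \<times> (real^'p) \<Rightarrow> real^'n \<Rightarrow> (real^'m) \<times> (real^'p) \<Rightarrow> ereal" where
  "duality_gap f g A B c T wk x w =
     ereal (Psi_prox f g A B c T wk x) + Xi_prox f g A B c wk w"

definition S_map ::
  "(real^'n \<Rightarrow> ereal) \<Rightarrow> (real^'m \<Rightarrow> ereal) \<Rightarrow> real^'n^'m \<Rightarrow> real^'n^'p \<Rightarrow> 'p set \<Rightarrow>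
   (real^'m) \<times> (real^'p) \<Rightarrow> ((real^'m) \<times> (real^'p)) set" where
  "S_map f g A B T w =
     (if \<forall>i\<in>-T. snd w $ i = 0
      then {- Q_map A B \<xi> + (u, v) | \<xi> u v.
              \<xi> \<in> subdifferential (conjugate_fun f) (- adjoint (Q_map A B) w) \<and>
              u \<in> subdifferential (conjugate_fun g) (fst w) \<and>
              (\<forall>i\<in>T. v $ i = 0)}
      else {})"

definition S_zeros ::
  "(real^'n \<Rightarrow> ereal) \<Rightarrow> (real^'m \<Rightarrow> ereal) \<Rightarrow> real^'n^'m \<Rightarrow> real^'n^'p \<Rightarrow> 'p set \<Rightarrow>
   ((real^'m) \<times> (real^'p)) set" where
  "S_zeros f g A B T = {w. 0 \<in> S_map f g A B T w}"


section \<open>The inner algorithm\<close>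

text \<open>Iterate, residual and search direction of the conjugate gradient method for
  \<open>K d = b\<close>. Once the residual is zero, division by zero makes the state stationary.\<close>

primrec cg_state ::
  "real^'n^'n \<Rightarrow> real^'n \<Rightarrow> real^'n \<Rightarrow> nat \<Rightarrow> (real^'n) \<times> (real^'n) \<times> (real^'n)" where
  "cg_state K b d0 0 = (d0, b - K *v d0, b - K *v d0)"
| "cg_state K b d0 (Suc l) =
     (let (d, r, s) = cg_state K b d0 l;
          a = (r \<bullet> r) / (s \<bullet> (K *v s));
          r' = r - a *\<^sub>R (K *v s);
          b' = (r' \<bullet> r') / (r \<bullet> r)
      in (d + a *\<^sub>R s, r', r' + b' *\<^sub>R s))"

definition hess_Psi ::
  "(real^'n \<Rightarrow> ereal) \<Rightarrow> (real^'m \<Rightarrow> ereal) \<Rightarrow> real^'n^'m \<Rightarrow> real^'n^'p \<Rightarrow> real \<Rightarrow> 'p set \<Rightarrow>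
   (real^'m) \<times> (real^'p) \<Rightarrow> real^'n \<Rightarrow> (real^'n^'n) set" where
  "hess_Psi f g A B c T wk x =
     {U + transpose A ** V ** A + c *\<^sub>R (transpose (row_part T B) ** row_part T B) | U V.
        U \<in> clarke_jacobian (gradient (f_prox f A B c wk)) x \<and>
        V \<in> clarke_jacobian (gradient (g_prox g c (fst wk))) (A *v x)}"

definition armijo ::
  "(real^'n \<Rightarrow> real) \<Rightarrow> real \<Rightarrow> real \<Rightarrow> real^'n \<Rightarrow> real^'n \<Rightarrow> nat \<Rightarrow> bool" where
  "armijo \<Phi> \<beta> \<zeta> x d q \<longleftrightarrow>
     \<Phi> (x + \<beta> ^ q *\<^sub>R d) \<le> \<Phi> x + \<zeta> * \<beta> ^ q * (gradient \<Phi> x \<bullet> d)"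

text \<open>One step from \<open>x\<close> to \<open>x'\<close> for the objective \<open>\<Phi>\<close> with generalized Hessian \<open>\<H>\<close>.
  The starting point \<open>d0\<close> of the conjugate gradient method is not prescribed.\<close>

definition sna_step ::
  "real \<Rightarrow> real \<Rightarrow> real \<Rightarrow> real \<Rightarrow> real \<Rightarrow> (real^'n \<Rightarrow> real) \<Rightarrow> (real^'n \<Rightarrow> (real^'n^'n) set) \<Rightarrow>
   real^'n \<Rightarrow> real^'n \<Rightarrow> bool" where
  "sna_step \<tau> \<tau>1 \<tau>2 \<beta> \<zeta> \<Phi> \<H> x x' \<longleftrightarrow>
     (\<exists>H\<in>\<H> x. \<exists>K d d0 l q.
        K = H + (\<tau>1 * norm (gradient \<Phi> x)) *\<^sub>R mat 1 \<and>
        d = fst (cg_state K (- gradient \<Phi> x) d0 l) \<and>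
        norm (K *v d + gradient \<Phi> x) \<le> \<tau>2 * norm (gradient \<Phi> x) powr (1 + \<tau>) \<and>
        armijo \<Phi> \<beta> \<zeta> x d q \<and> (\<forall>q'<q. \<not> armijo \<Phi> \<beta> \<zeta> x d q') \<and>
        x' = x + \<beta> ^ q *\<^sub>R d)"

definition sna_dual ::
  "(real^'m \<Rightarrow> ereal) \<Rightarrow> real^'n^'m \<Rightarrow> real^'n^'p \<Rightarrow> real \<Rightarrow> 'p set \<Rightarrow> (real^'m) \<times> (real^'p) \<Rightarrow>
   real^'n \<Rightarrow> (real^'m) \<times> (real^'p)" where
  "sna_dual g A B c T wk x =
     (prox c (conjugate_fun g) (c *\<^sub>R (A *v x) + fst wk), vec_part T (snd wk + c *\<^sub>R (B *v x)))"


section \<open>The outer algorithm\<close>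

text \<open>The linear order on the index type \<open>'p\<close> is the order in which the coordinates
  are visited.\<close>

definition coordinate_sweep ::
  "(real^'n \<Rightarrow> ereal) \<Rightarrow> (real^'m \<Rightarrow> ereal) \<Rightarrow> real^'n^'m \<Rightarrow> real^'n^('p::{finite,linorder}) \<Rightarrow>
   real^('p::{finite,linorder}) \<Rightarrow> real \<Rightarrow> (real^'m) \<times> (real^('p::{finite,linorder})) \<Rightarrow>
   real^('p::{finite,linorder}) \<Rightarrow> bool" where
  "coordinate_sweep f g A B \<mu> c wk zt \<longleftrightarrow>
     (\<forall>i. is_arg_min
        (\<lambda>t. Xi_prox f g A B c wk
               (fst wk, \<chi> j. if j < i then zt $ j else if j = i then t else snd wk $ j)
             + ereal (if t \<noteq> 0 then \<mu> $ i else 0))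
        (\<lambda>_. True) (zt $ i))"

text \<open>\<open>zt k\<close> is the result of the coordinate minimization in iteration \<open>k\<close>, so
  \<open>index_supp (zt k)\<close> is \<open>T\<^sub>k\<close>; \<open>xs\<close> is the sequence of inner iterates, which is
  stopped at index \<open>j\<close>. The stopping criteria are stated separately.\<close>

definition ppsna_sequence ::
  "(real^'n \<Rightarrow> ereal) \<Rightarrow> (real^'m \<Rightarrow> ereal) \<Rightarrow> real^'n^'m \<Rightarrow> real^'n^('p::{finite,linorder}) \<Rightarrow>
   real^('p::{finite,linorder}) \<Rightarrow> (nat \<Rightarrow> real) \<Rightarrow> real \<Rightarrow> real \<Rightarrow> real \<Rightarrow> real \<Rightarrow> real \<Rightarrow>
   (nat \<Rightarrow> real^'n) \<Rightarrow> (nat \<Rightarrow> (real^'m) \<times> (real^('p::{finite,linorder}))) \<Rightarrow>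
   (nat \<Rightarrow> real^('p::{finite,linorder})) \<Rightarrow> bool" where
  "ppsna_sequence f g A B \<mu> \<gamma> \<tau> \<tau>1 \<tau>2 \<beta> \<zeta> x w zt \<longleftrightarrow>
     fst (w 0) \<in> edom (conjugate_fun g) \<and>
     (\<forall>k. coordinate_sweep f g A B \<mu> (\<gamma> k) (w k) (zt k) \<and>
          (\<exists>xs j. xs 0 = x k \<and>
             (\<forall>i<j. sna_step \<tau> \<tau>1 \<tau>2 \<beta> \<zeta>
                (Psi_prox f g A B (\<gamma> k) (index_supp (zt k)) (w k))
                (hess_Psi f g A B (\<gamma> k) (index_supp (zt k)) (w k)) (xs i) (xs (Suc i))) \<and>
             x (Suc k) = xs j \<and>
             w (Suc k) = sna_dual g A B (\<gamma> k) (index_supp (zt k)) (w k) (xs j)))"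

definition eventual_value :: "(nat \<Rightarrow> 'a) \<Rightarrow> 'a" where
  "eventual_value T = (THE S. \<forall>\<^sub>F k in sequentially. T k = S)"


section \<open>Regularity, error bound and rate\<close>

text \<open>Relative interiors are not required of polyhedral functions in the constraint
  qualification.\<close>

definition ri_edom :: "('a::euclidean_space \<Rightarrow> ereal) \<Rightarrow> 'a set" where
  "ri_edom \<phi> = (if polyhedral_function \<phi> then edom \<phi> else rel_interior (edom \<phi>))"

definition error_bound ::
  "('a::real_normed_vector \<Rightarrow> 'a set) \<Rightarrow> 'a set \<Rightarrow> real \<Rightarrow> real \<Rightarrow> bool" where
  "error_bound S Z \<nu> \<kappa> \<longleftrightarrow>
     (\<forall>w. edist_set w Z \<le> ereal \<nu> \<longrightarrow> edist_set w Z \<le> ereal \<kappa> * edist_set 0 (S w))"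

definition limit_rate :: "real \<Rightarrow> real \<Rightarrow> real \<Rightarrow> real" where
  "limit_rate \<kappa> lam c = \<kappa> * lam / sqrt (c\<^sup>2 + \<kappa>\<^sup>2 * lam\<^sup>2)"

definition rate :: "real \<Rightarrow> real \<Rightarrow> real \<Rightarrow> real \<Rightarrow> real" where
  "rate \<kappa> lam c e = inverse (1 - e) * (e + (1 + e) * limit_rate \<kappa> lam c)"

end

theory Submission
  imports Defs
begin

text \<open>For a fixed index set \<open>T\<close>, the exact minimizer \<open>w\<^sub>1\<close> of \<open>\<Xi>\<^sub>k\<close> over \<open>z\<close> vanishing off \<open>T\<close>
  satisfies \<open>-M(w\<^sub>1 - w\<^sup>k)/\<gamma>\<^sub>k \<in> \<S>(w\<^sub>1)\<close>: coercivity makes \<open>f\<^sup>*\<close> finite everywhere, so the sum and chain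
  rules for subdifferentials apply. By weak duality the gap bounds
  \<open>\<parallel>w - w\<^sub>1\<parallel>\<^sub>M\<^sup>2 / (2\<gamma>\<^sub>k)\<close>. The error bound at \<open>w\<^sub>1\<close> together with
  \<open>\<parallel>w\<^sub>1 - u\<parallel>\<^sub>M\<^sup>2 + \<parallel>w\<^sub>1 - w\<^sup>k\<parallel>\<^sub>M\<^sup>2 \<le> \<parallel>w\<^sup>k - u\<parallel>\<^sub>M\<^sup>2\<close> for zeros \<open>u\<close> of \<open>\<S>\<close> gives the contraction of the
  exact step, and (C3) transfers it to the inexact one. If \<open>\<S>\<close> has no zero, both distances are infinite.

  The sets \<open>T\<^sub>k\<close> stabilize because \<open>\<Xi>(w\<^sup>k) + \<Sum>\<mu>\<^sub>i 1{z\<^sub>i\<^sup>k \<noteq> 0}\<close> decreases, by (C1), at least by a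
  multiple of \<open>\<parallel>w\<^sup>k\<^sup>+\<^sup>1 - w\<^sup>k\<parallel>\<^sub>M\<^sup>2\<close>. With (C2) this forces consecutive points obtained by coordinate
  minimization to approach each other, while their nonzero coordinates stay bounded away from
  \<open>0\<close>: a tiny nonzero coordinate costs \<open>\<mu>\<^sub>i\<close> and changes \<open>\<Xi>\<^sub>k\<close> by less.\<close>

section \<open>Conjugate functions and proximal points\<close>

text \<open>Indexing by points of \<open>epi \<phi>\<close> makes the conjugate a supremum of finite
  affine functions of \<open>s\<close>. Its epigraph is then an intersection of closed half-spaces,
  from which closedness, convexity and the Fenchel-Young inequality are read off.\<close>

lemma epi_conjugate_fun:
  assumes "\<And>x. \<phi> x \<noteq> -\<infinity>"
  shows "epi (conjugate_fun \<phi>) = (\<Inter>(x, t)\<in>epi \<phi>. {(s, r). s \<bullet> x - t \<le> r})"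
proof -
  have "conjugate_fun \<phi> s \<le> ereal r \<longleftrightarrow> (\<forall>x t. \<phi> x \<le> ereal t \<longrightarrow> s \<bullet> x - t \<le> r)" for s r
  proof
    assume *: "conjugate_fun \<phi> s \<le> ereal r"
    show "\<forall>x t. \<phi> x \<le> ereal t \<longrightarrow> s \<bullet> x - t \<le> r"
    proof (intro allI impI)
      fix x t assume t: "\<phi> x \<le> ereal t"
      have "ereal (s \<bullet> x) - \<phi> x \<le> ereal r"
        using * unfolding conjugate_fun_def by (meson SUP_le_iff UNIV_I)
      with t assms[of x] show "s \<bullet> x - t \<le> r" by (cases "\<phi> x") auto
    qed
  next
    assume *: "\<forall>x t. \<phi> x \<le> ereal t \<longrightarrow> s \<bullet> x - t \<le> r"
    show "conjugate_fun \<phi> s \<le> ereal r"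
      unfolding conjugate_fun_def
    proof (rule SUP_least)
      fix x
      show "ereal (s \<bullet> x) - \<phi> x \<le> ereal r"
        using assms[of x] *[rule_format, of x "real_of_ereal (\<phi> x)"] by (cases "\<phi> x") auto
    qed
  qed
  then show ?thesis by (auto simp: epi_def)
qed

lemma fenchel_young:
  assumes "\<And>x. \<phi> x \<noteq> -\<infinity>" and "\<phi> x \<le> ereal t" and "conjugate_fun \<phi> s \<le> ereal r"
  shows "s \<bullet> x - t \<le> r"
  using epi_conjugate_fun[of \<phi>, OF assms(1)] assms(2,3) by (auto simp: epi_def set_eq_iff)

lemma closed_epi_conjugate_fun:
  fixes \<phi> :: "'a::euclidean_space \<Rightarrow> ereal"
  assumes "\<And>x. \<phi> x \<noteq> -\<infinity>"
  shows "closed (epi (conjugate_fun \<phi>))"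
proof -
  have "closed {(s, r). s \<bullet> x - t \<le> r}" for x :: 'a and t
    unfolding case_prod_beta by (intro closed_Collect_le continuous_intros)
  then show ?thesis unfolding epi_conjugate_fun[of \<phi>, OF assms] by (auto intro!: closed_INT)
qed

lemma convex_epi_conjugate_fun:
  fixes \<phi> :: "'a::euclidean_space \<Rightarrow> ereal"
  assumes "\<And>x. \<phi> x \<noteq> -\<infinity>"
  shows "convex (epi (conjugate_fun \<phi>))"
proof -
  have "convex {(s, r). s \<bullet> x - t \<le> r}" for x :: 'a and t
  proof -
    have "{(s, r). s \<bullet> x - t \<le> r} = {p. (x, -1) \<bullet> p \<le> t}"
      by (auto simp: inner_commute algebra_simps)
    then show ?thesis using convex_halfspace_le by metis
  qed
  then show ?thesis unfolding epi_conjugate_fun[of \<phi>, OF assms] by (auto intro!: convex_INT)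
qed

lemma conjugate_fun_neq_MInf:
  assumes "\<And>x. \<phi> x \<noteq> -\<infinity>" and "edom \<phi> \<noteq> {}"
  shows "conjugate_fun \<phi> s \<noteq> -\<infinity>"
proof -
  from assms(2) obtain x where x: "\<phi> x < \<infinity>" by (auto simp: edom_def)
  have "ereal (s \<bullet> x) - \<phi> x \<le> conjugate_fun \<phi> s"
    unfolding conjugate_fun_def by (rule SUP_upper) simp
  with x assms(1)[of x] show ?thesis by (cases "\<phi> x") auto
qed

lemma convex_on_real_of_ereal:
  assumes ninf: "\<And>x. \<psi> x \<noteq> -\<infinity>" and "convex (epi \<psi>)"
  shows "convex_on (edom \<psi>) (\<lambda>x. real_of_ereal (\<psi> x))"
proof -
  have in_epi: "(x, real_of_ereal (\<psi> x)) \<in> epi \<psi>" if "x \<in> edom \<psi>" for x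
    using that ninf[of x] by (cases "\<psi> x") (auto simp: edom_def epi_def)
  have step: "\<psi> (u *\<^sub>R x + v *\<^sub>R y) \<le> ereal (u * real_of_ereal (\<psi> x) + v * real_of_ereal (\<psi> y))"
    if "x \<in> edom \<psi>" "y \<in> edom \<psi>" "0 \<le> u" "0 \<le> v" "u + v = 1" for x y u v
    using convexD[OF assms(2) in_epi[OF that(1)] in_epi[OF that(2)] that(3-5)]
    by (simp add: epi_def)
  have "convex (edom \<psi>)"
    by (rule convexI) (use step in \<open>force simp: edom_def\<close>)
  moreover have "real_of_ereal (\<psi> (u *\<^sub>R x + v *\<^sub>R y))
      \<le> u * real_of_ereal (\<psi> x) + v * real_of_ereal (\<psi> y)"
    if "x \<in> edom \<psi>" "y \<in> edom \<psi>" "0 \<le> u" "0 \<le> v" "u + v = 1" for x y u v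
    using step[OF that] ninf[of "u *\<^sub>R x + v *\<^sub>R y"] by (cases "\<psi> (u *\<^sub>R x + v *\<^sub>R y)") auto
  ultimately show ?thesis unfolding convex_on_def by blast
qed

text \<open>Lower semicontinuity and compactness: points of the ball with values below -n would
  cluster at a point whose value lies below every -N, hence is -\<infinity>.\<close>

lemma closed_epi_bounded_below_cball:
  fixes \<phi> :: "'a::euclidean_space \<Rightarrow> ereal"
  assumes ninf: "\<And>x. \<phi> x \<noteq> -\<infinity>" and cl: "closed (epi \<phi>)"
  obtains m where "\<And>x. norm x \<le> b \<Longrightarrow> ereal m \<le> \<phi> x"
proof (rule ccontr)
  assume "\<not> thesis"
  then have "\<forall>n::nat. \<exists>x. norm x \<le> b \<and> \<phi> x < ereal (- real n)"
    using that by (meson not_le)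
  then obtain X where X: "\<And>n. norm (X n) \<le> b" "\<And>n::nat. \<phi> (X n) < ereal (- real n)" by metis
  have "seq_compact (cball (0::'a) b)" using compact_cball compact_imp_seq_compact by blast
  then obtain l r where l: "strict_mono r" "(X \<circ> r) \<longlonglongrightarrow> l"
    using X(1) unfolding seq_compact_def by (metis mem_cball_0)
  \<comment> \<open>The height -N is held fixed along the subsequence:
    \<open>N \<le> n \<le> r n\<close> puts all later points into the epigraph at this height, and
    closedness passes this on to \<open>l\<close>.\<close>
  have *: "\<phi> l \<le> ereal (- real N)" for N :: nat
  proof -
    have "(\<lambda>n. ((X \<circ> r) n, - real N)) \<longlonglongrightarrow> (l, - real N)"
      by (intro tendsto_Pair l(2) tendsto_const)
    moreover have "\<forall>\<^sub>F n in sequentially. ((X \<circ> r) n, - real N) \<in> epi \<phi>"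
      using eventually_ge_at_top[of N]
    proof eventually_elim
      case (elim n)
      then have "N \<le> r n" using seq_suble[OF l(1), of n] by linarith
      then have "\<phi> (X (r n)) \<le> ereal (- real N)"
        by (intro order.trans[OF less_imp_le[OF X(2)]]) simp
      then show ?case by (simp add: epi_def)
    qed
    ultimately have "(l, - real N) \<in> epi \<phi>"
      using Lim_in_closed_set[OF cl _ sequentially_bot] by simp
    then show ?thesis by (simp add: epi_def)
  qed
  show False
  proof (cases "\<phi> l")
    case (real t)
    obtain N :: nat where "- t < real N" using reals_Archimedean2 by blast
    then show False using *[of N] real by simp
  next
    case PInf then show False using *[of 0] by simp
  next
    case MInf then show False using ninf by simp
  qed
qed

text \<open>Outside a large ball superlinear growth gives
  \<open>norm s * norm x \<le> \<phi> x\<close>, which absorbs the linear term; on the ball \<phi>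
  is bounded below by \<open>m\<close>.\<close>

lemma edom_conjugate_fun_coercive:
  fixes \<phi> :: "'a::euclidean_space \<Rightarrow> ereal"
  assumes ninf: "\<And>x. \<phi> x \<noteq> -\<infinity>" and cl: "closed (epi \<phi>)"
    and co: "Liminf at_infinity (\<lambda>v. \<phi> v / ereal (norm v)) = \<infinity>"
  shows "edom (conjugate_fun \<phi>) = UNIV"
proof -
  have "s \<in> edom (conjugate_fun \<phi>)" for s
  proof -
    have "ereal (norm s) < Liminf at_infinity (\<lambda>v. \<phi> v / ereal (norm v))" using co by simp
    then have "\<forall>\<^sub>F v in at_infinity. ereal (norm s) < \<phi> v / ereal (norm v)"
      by (rule less_LiminfD)
    then obtain b where b: "\<And>v. b \<le> norm v \<Longrightarrow> ereal (norm s) < \<phi> v / ereal (norm v)"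
      unfolding eventually_at_infinity by auto
    \<comment> \<open>The radius is at least 1, so outside the ball \<open>norm x\<close> is
      positive and the quotient can be multiplied out.\<close>
    obtain m where m: "\<And>x. norm x \<le> max b 1 \<Longrightarrow> ereal m \<le> \<phi> x"
      using closed_epi_bounded_below_cball[OF ninf cl] by blast
    let ?r = "max 0 (norm s * max b 1 - m)"
    have "s \<bullet> x - t \<le> max 0 (norm s * max b 1 - m)" if t: "\<phi> x \<le> ereal t" for x t
    proof (cases "norm x \<le> max b 1")
      case True
      then have "m \<le> t" using m[OF True] t by (meson ereal_less_eq(3) order.trans)
      moreover have "s \<bullet> x \<le> norm s * max b 1"
        by (meson True mult_left_mono norm_cauchy_schwarz norm_ge_zero order.trans)
      ultimately show ?thesis by linarith
    next
      case False
      then have xb: "b \<le> norm x" "norm x > 0" by auto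
      have "norm s * norm x \<le> t"
        using b[OF xb(1)] t xb(2) ninf[of x] by (cases "\<phi> x") (auto simp: field_simps)
      then show ?thesis using norm_cauchy_schwarz[of s x] by linarith
    qed
    then have "(s, ?r) \<in> epi (conjugate_fun \<phi>)"
      unfolding epi_conjugate_fun[of \<phi>, OF ninf] by (auto simp: epi_def)
    then have "conjugate_fun \<phi> s \<le> ereal ?r" by (simp add: epi_def del: ereal_max)
    then show ?thesis unfolding edom_def by (auto intro: le_less_trans simp del: ereal_max)
  qed
  then show ?thesis by blast
qed

text \<open>\<open>real_of_ereal\<close> maps both infinities to 0, so both have to be excluded: the
  bound \<open>l\<close> rules out -\<infinity>, and a point of the domain rules out
  \<infinity>.\<close>

lemma le_real_of_moreau_env:
  assumes "\<And>x. \<psi> x \<noteq> -\<infinity>" and "edom \<psi> \<noteq> {}"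
    and le: "\<And>x t. \<psi> x \<le> ereal t \<Longrightarrow> l \<le> 1 / (2 * \<sigma>) * (norm (x - c))\<^sup>2 + t"
  shows "l \<le> real_of_ereal (moreau_env \<sigma> \<psi> c)"
proof -
  have "ereal l \<le> moreau_env \<sigma> \<psi> c"
    unfolding moreau_env_def
  proof (rule INF_greatest)
    fix x
    show "ereal l \<le> prox_objective \<sigma> \<psi> c x"
      using assms(1)[of x] le[of x "real_of_ereal (\<psi> x)"]
      by (cases "\<psi> x") (auto simp: prox_objective_def)
  qed
  moreover from assms(2) obtain x where "\<psi> x < \<infinity>" by (auto simp: edom_def)
  then have "moreau_env \<sigma> \<psi> c < \<infinity>"
    unfolding moreau_env_def
    by (intro le_less_trans[OF INF_lower[of x]]) (auto simp: prox_objective_def)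
  ultimately show ?thesis by (cases "moreau_env \<sigma> \<psi> c") auto
qed

section \<open>Fenchel duality by separation\<close>

lemma fenchel_duality_subgradient:
  fixes F :: "'a::euclidean_space \<Rightarrow> real" and h :: "'b::euclidean_space \<Rightarrow> real"
  assumes F: "convex_on UNIV F" and L: "linear L" and h: "convex_on C h" and w0: "w0 \<in> C"
    and min: "\<And>w. w \<in> C \<Longrightarrow> F (L w0) + h w0 \<le> F (L w) + h w"
  obtains \<xi> where "\<And>a. F (L w0) + \<xi> \<bullet> (a - L w0) \<le> F a"
    and "\<And>w. w \<in> C \<Longrightarrow> h w0 - \<xi> \<bullet> (L w - L w0) \<le> h w"
proof -
  define m where "m = F (L w0) + h w0"
  define S where "S = {(L w, r) | w r. w \<in> C \<and> r < m - h w}"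
  define E where "E = {(a, t). F a \<le> t}"
  have "convex E"
    using F convex_epigraph[of UNIV F] by (simp add: E_def epigraph_def case_prod_unfold)
  moreover have "convex S"
  proof (rule convexI)
    fix p q :: "'a \<times> real" and u v :: real
    assume "p \<in> S" "q \<in> S" and uv: "0 \<le> u" "0 \<le> v" "u + v = 1"
    then obtain w r w' r' where p: "p = (L w, r)" "w \<in> C" "r < m - h w"
      and q: "q = (L w', r')" "w' \<in> C" "r' < m - h w'" unfolding S_def by blast
    have "u *\<^sub>R w + v *\<^sub>R w' \<in> C" using h uv p q by (meson convexD convex_on_imp_convex)
    moreover have "h (u *\<^sub>R w + v *\<^sub>R w') \<le> u * h w + v * h w'"
      using h uv p q unfolding convex_on_def by blast
    moreover have "u * r + v * r' < u * (m - h w) + v * (m - h w')"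
    proof (cases "u = 0")
      case True then show ?thesis using uv q by simp
    next
      case False
      then have "u * r < u * (m - h w)" using uv p by simp
      moreover have "v * r' \<le> v * (m - h w')" using uv q by (simp add: mult_left_mono)
      ultimately show ?thesis by linarith
    qed
    moreover have "u * (m - h w) + v * (m - h w') = m - (u * h w + v * h w')"
    proof -
      have "u * m + v * m = m" using uv by (metis distrib_right mult_1)
      then show ?thesis by (simp add: algebra_simps)
    qed
    moreover have "u *\<^sub>R p + v *\<^sub>R q = (L (u *\<^sub>R w + v *\<^sub>R w'), u * r + v * r')"
      by (simp add: p q linear_add[OF L] linear_scale[OF L])
    ultimately show "u *\<^sub>R p + v *\<^sub>R q \<in> S" unfolding S_def by force
  qed
  moreover have "(L w0, m - h w0 - 1) \<in> S" unfolding S_def using w0 by force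
  moreover have "(0, F 0) \<in> E" by (simp add: E_def)
  moreover have "S \<inter> E = {}"
    using min unfolding S_def E_def m_def by force
  ultimately obtain k b where k: "k \<noteq> 0" "\<forall>x\<in>S. k \<bullet> x \<le> b" "\<forall>x\<in>E. b \<le> k \<bullet> x"
    using separating_hyperplane_sets[of S E] by blast
  obtain p \<alpha> where p: "k = (p, \<alpha>)" by (cases k)
  have Eb: "b \<le> p \<bullet> a + \<alpha> * t" if "F a \<le> t" for a t
    using k(3) that by (force simp: E_def p)
  \<comment> \<open>Points of \<open>E\<close> can be raised arbitrarily, so a negative vertical
    component would violate the lower bound \<open>b\<close>.\<close>
  have "\<not> \<alpha> < 0"
  proof
    assume "\<alpha> < 0"
    then have "\<alpha> * max (F 0) ((b - 1) / \<alpha>) \<le> b - 1" by (simp add: field_simps max_def)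
    with Eb[of 0 "max (F 0) ((b - 1) / \<alpha>)"] show False by simp
  qed
  \<comment> \<open>Since \<open>F\<close> is finite everywhere, a vertical hyperplane would bound
    \<open>p \<bullet> a\<close> below by \<open>b\<close> for all \<open>a\<close>; a suitable
    multiple of \<open>p\<close> gives the value \<open>b - 1\<close>.\<close>
  moreover have "\<alpha> \<noteq> 0"
  proof
    assume 0: "\<alpha> = 0"
    then have "p \<noteq> 0" using k(1) p by (auto simp: zero_prod_def)
    then show False using Eb[of "((b - 1) / (p \<bullet> p)) *\<^sub>R p" "F (((b - 1) / (p \<bullet> p)) *\<^sub>R p)"] 0 by simp
  qed
  ultimately have \<alpha>: "\<alpha> > 0" by simp
  \<comment> \<open>The strict inequality in \<open>S\<close> is removed by letting \<open>r\<close>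
    increase to \<open>m - h w\<close>.\<close>
  have Sb: "p \<bullet> L w + \<alpha> * (m - h w) \<le> b" if "w \<in> C" for w
  proof -
    have "m - h w \<le> (b - p \<bullet> L w) / \<alpha>"
    proof (rule dense_le)
      fix r assume "r < m - h w"
      then have "(L w, r) \<in> S" using that unfolding S_def by blast
      then have "p \<bullet> L w + \<alpha> * r \<le> b" using k(2) by (force simp: p)
      then show "r \<le> (b - p \<bullet> L w) / \<alpha>" using \<alpha> by (simp add: field_simps)
    qed
    then show ?thesis using \<alpha> by (simp add: field_simps)
  qed
  \<comment> \<open>Together with \<open>Eb\<close> at \<open>L w0\<close>, the hyperplane passes
    through \<open>(L w0, F (L w0))\<close>, the point from which both subgradient inequalities are
    measured.\<close>
  have b0: "p \<bullet> L w0 + \<alpha> * F (L w0) \<le> b" using Sb[OF w0] by (simp add: m_def)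
  show thesis
  proof
    fix a
    have "p \<bullet> L w0 + \<alpha> * F (L w0) \<le> p \<bullet> a + \<alpha> * F a" using b0 Eb[of a "F a"] by simp
    then show "F (L w0) + (- (1 / \<alpha>) *\<^sub>R p) \<bullet> (a - L w0) \<le> F a"
      using \<alpha> by (simp add: field_simps inner_diff_right)
  next
    fix w assume "w \<in> C"
    then have "p \<bullet> L w + \<alpha> * (m - h w) \<le> p \<bullet> L w0 + \<alpha> * F (L w0)"
      using Sb[of w] Eb[of "L w0" "F (L w0)"] by simp
    then show "h w0 - (- (1 / \<alpha>) *\<^sub>R p) \<bullet> (L w - L w0) \<le> h w"
      using \<alpha> by (simp add: field_simps inner_diff_right m_def)
  qed
qed

section \<open>Existence and optimality condition of proximal points\<close>

lemma prox_minimizer_exists: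
  fixes \<phi> :: "'b::euclidean_space \<Rightarrow> real" and K :: "'b \<Rightarrow> 'c::euclidean_space"
  assumes K: "linear K" "\<And>w. norm w \<le> norm (K w)"
    and cl: "closed {(w, t). w \<in> C \<and> \<phi> w \<le> t}" and w2: "w2 \<in> C"
    and minorant: "\<And>w. w \<in> C \<Longrightarrow> a \<bullet> w + b \<le> \<phi> w" and c: "c > 0"
  obtains w1 where "w1 \<in> C"
    and "\<And>w. w \<in> C \<Longrightarrow> \<phi> w1 + 1 / (2 * c) * (norm (K (w1 - w0)))\<^sup>2
                      \<le> \<phi> w + 1 / (2 * c) * (norm (K (w - w0)))\<^sup>2"
proof -
  \<comment> \<open>\<phi> is only lower semicontinuous on \<open>C\<close>, so the height
    \<open>t\<close> is minimized over the compact truncated epigraph \<open>E\<close> instead of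
    the objective over \<open>C\<close>.\<close>
  define q where "q w = 1 / (2 * c) * (norm (K (w - w0)))\<^sup>2" for w
  define v where "v = \<phi> w2 + q w2"
  define E where "E = {(w, t). w \<in> C \<and> \<phi> w + q w \<le> t \<and> t \<le> v}"
  have contK: "continuous_on S (\<lambda>p. K (k p))" if "continuous_on S k" for S and k :: "'b \<times> real \<Rightarrow> 'b"
    using continuous_on_compose2[OF linear_continuous_on[OF K(1)[THEN linear_conv_bounded_linear[THEN iffD1]], of UNIV] that]
    by auto
  have "closed E"
  proof -
    \<comment> \<open>\<open>E\<close> is the preimage of the closed epigraph of \<phi> under the
      shear taking \<open>(w, t)\<close> to \<open>(w, t - q w)\<close>, cut off at height
      \<open>v\<close>.\<close>
    have "closed ((\<lambda>p. (fst p, snd p - q (fst p))) -` {(w, t). w \<in> C \<and> \<phi> w \<le> t})"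
      unfolding q_def by (intro closed_vimage cl continuous_intros contK)
    moreover have "closed {p :: 'b \<times> real. snd p \<le> v}"
      by (intro closed_Collect_le continuous_intros)
    ultimately have "closed ((\<lambda>p. (fst p, snd p - q (fst p))) -` {(w, t). w \<in> C \<and> \<phi> w \<le> t}
        \<inter> {p. snd p \<le> v})" by (rule closed_Int)
    also have "\<dots> = E" unfolding E_def by auto
    finally show ?thesis .
  qed
  moreover have "bounded E"
  proof -
    \<comment> \<open>By the affine minorant and the height bound \<open>v\<close>, points of
      \<open>E\<close> at distance \<open>d\<close> from \<open>w0\<close> satisfy
      \<open>d^2 / (2 * c) \<le> norm a * d + \<kappa>\<close>; \<open>R\<close> is chosen so that
      this fails for \<open>d > R\<close>.\<close>
    define \<kappa> where "\<kappa> = v - b - a \<bullet> w0"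
    define R where "R = 1 + 2 * c * (norm a + \<bar>\<kappa>\<bar>)"
    have "E \<subseteq> cball w0 R \<times> {a \<bullet> w0 - norm a * R + b .. v}"
    proof
      fix p assume "p \<in> E"
      then obtain w t where p: "p = (w, t)" "w \<in> C" "\<phi> w + q w \<le> t" "t \<le> v"
        unfolding E_def by blast
      define d where "d = norm (w - w0)"
      have aw: "a \<bullet> w \<ge> a \<bullet> w0 - norm a * d"
        using norm_cauchy_schwarz[of "-a" "w - w0"] by (simp add: d_def inner_diff_right)
      have q: "q w \<ge> 1 / (2 * c) * d\<^sup>2"
        unfolding q_def d_def using c K(2)[of "w - w0"] by (simp add: divide_right_mono power_mono)
      have q0: "1 / (2 * c) * d\<^sup>2 \<ge> 0" using c by simp
      have "d \<le> R"
      proof (rule ccontr)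
        assume "\<not> d \<le> R"
        moreover have "2 * c * (norm a + \<bar>\<kappa>\<bar>) \<ge> 0" using c by simp
        ultimately have d: "d > 1" "d > 2 * c * (norm a + \<bar>\<kappa>\<bar>)" unfolding R_def by linarith+
        have "d / (2 * c) > norm a + \<bar>\<kappa>\<bar>" using d(2) c by (simp add: field_simps)
        then have "d * (d / (2 * c)) > d * (norm a + \<bar>\<kappa>\<bar>)"
          using d(1) by (intro mult_strict_left_mono) auto
        moreover have "d * \<bar>\<kappa>\<bar> \<ge> \<bar>\<kappa>\<bar>" using d(1) by (simp add: mult_le_cancel_right1)
        ultimately have "1 / (2 * c) * d\<^sup>2 > norm a * d + \<kappa>"
          by (simp add: power2_eq_square algebra_simps)
        then show False using q aw minorant[OF p(2)] p(3,4) unfolding \<kappa>_def by linarith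
      qed
      moreover have "norm a * d \<le> norm a * R" using \<open>d \<le> R\<close> by (simp add: mult_left_mono)
      ultimately show "p \<in> cball w0 R \<times> {a \<bullet> w0 - norm a * R + b .. v}"
        using p q q0 aw minorant[OF p(2)] by (auto simp: dist_norm norm_minus_commute d_def)
    qed
    moreover have "bounded (cball w0 R \<times> {a \<bullet> w0 - norm a * R + b .. v})"
      by (intro bounded_Times bounded_cball bounded_closed_interval)
    ultimately show ?thesis using bounded_subset by blast
  qed
  ultimately have "compact E" by (simp add: compact_eq_bounded_closed)
  moreover have "(w2, v) \<in> E" using w2 by (simp add: E_def v_def)
  moreover have "continuous_on E snd" by (intro continuous_intros)
  ultimately obtain p where p: "p \<in> E" "\<And>p'. p' \<in> E \<Longrightarrow> snd p \<le> snd p'"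
    using continuous_attains_inf[of E snd] by blast
  show thesis
  proof
    show "fst p \<in> C" using p(1) by (auto simp: E_def)
    fix w assume w: "w \<in> C"
    have "\<phi> (fst p) + q (fst p) \<le> snd p" "snd p \<le> v" using p(1) by (auto simp: E_def)
    moreover have "snd p \<le> \<phi> w + q w" if "\<phi> w + q w \<le> v"
      using p(2)[of "(w, \<phi> w + q w)"] that w by (simp add: E_def)
    ultimately have "\<phi> (fst p) + q (fst p) \<le> \<phi> w + q w" by linarith
    then show "\<phi> (fst p) + 1 / (2 * c) * (norm (K (fst p - w0)))\<^sup>2
        \<le> \<phi> w + 1 / (2 * c) * (norm (K (w - w0)))\<^sup>2" by (simp add: q_def)
  qed
qed

lemma prox_minimizer_variational:
  fixes \<phi> :: "'b::real_vector \<Rightarrow> real" and K :: "'b \<Rightarrow> 'c::real_inner"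
  assumes K: "linear K" and \<phi>: "convex_on C \<phi>" and c: "c > 0" and C: "w1 \<in> C" "w \<in> C"
    and min: "\<And>w. w \<in> C \<Longrightarrow> \<phi> w1 + 1 / (2 * c) * (norm (K (w1 - w0)))\<^sup>2
                      \<le> \<phi> w + 1 / (2 * c) * (norm (K (w - w0)))\<^sup>2"
  shows "\<phi> w1 - 1 / c * (K (w1 - w0) \<bullet> K (w - w1)) \<le> \<phi> w"
proof (rule ccontr)
  define e where "e = 1 / (2 * c) * (norm (K (w - w1)))\<^sup>2"
  define D where "D = \<phi> w1 - 1 / c * (K (w1 - w0) \<bullet> K (w - w1)) - \<phi> w"
  assume "\<not> ?thesis"
  then have D: "D > 0" by (simp add: D_def)
  have e: "e \<ge> 0" using c by (simp add: e_def)
  \<comment> \<open>Minimality along the segment gives \<open>D \<le> t * e\<close> for a violation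
    \<open>D > 0\<close>. This \<open>t\<close> makes \<open>t * e = D * e / (D + e) < D\<close>, so
    no limit in \<open>t\<close> has to be taken.\<close>
  define t where "t = D / (D + e)"
  have t: "0 < t" "t \<le> 1" using D e by (auto simp: t_def)
  define u where "u = (1 - t) *\<^sub>R w1 + t *\<^sub>R w"
  have u: "u \<in> C" "\<phi> u \<le> (1 - t) * \<phi> w1 + t * \<phi> w"
    using \<phi> C t unfolding u_def convex_on_def by (auto intro: convexD)
  have "u - w0 = (w1 - w0) + t *\<^sub>R (w - w1)" by (simp add: u_def algebra_simps)
  then have "K (u - w0) = K (w1 - w0) + t *\<^sub>R K (w - w1)"
    by (simp only: linear_add[OF K] linear_scale[OF K])
  then have "1 / (2 * c) * (norm (K (u - w0)))\<^sup>2
      = 1 / (2 * c) * (norm (K (w1 - w0)))\<^sup>2 + t * (1 / c * (K (w1 - w0) \<bullet> K (w - w1))) + t * t * e"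
    using c unfolding e_def power2_norm_eq_inner
    by (simp add: inner_add_left inner_add_right inner_commute field_simps)
  then have "t * D \<le> t * (t * e)" using min[OF u(1)] u(2) by (simp add: D_def algebra_simps)
  then have "D \<le> t * e" using t by simp
  then have "D * D \<le> 0" using D e by (simp add: t_def field_simps)
  then show False using D mult_pos_pos[of D D] by linarith
qed

text \<open>Replaces an extended-real distance by a real greatest lower bound, so that distances to
  a set can be estimated without choosing nearest points.\<close>

lemma INF_ereal_eq_real:
  assumes "Z \<noteq> {}" and "\<And>u. 0 \<le> h u"
  obtains d where "0 \<le> d" and "(INF u\<in>Z. ereal (h u)) = ereal d" and "\<And>u. u \<in> Z \<Longrightarrow> d \<le> h u"
    and "\<And>r. (\<And>u. u \<in> Z \<Longrightarrow> r \<le> h u) \<Longrightarrow> r \<le> d"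
proof -
  let ?I = "INF u\<in>Z. ereal (h u)"
  obtain u0 where u0: "u0 \<in> Z" using assms(1) by auto
  have "?I \<le> ereal (h u0)" by (rule INF_lower[OF u0])
  moreover have "0 \<le> ?I" by (rule INF_greatest) (simp add: assms(2))
  ultimately obtain d where d: "?I = ereal d" by (cases ?I) auto
  show thesis
  proof (rule that[of d])
    show "0 \<le> d" using \<open>0 \<le> ?I\<close> d by simp
    show "?I = ereal d" by (rule d)
    show "d \<le> h u" if "u \<in> Z" for u using INF_lower[OF that, of "\<lambda>u. ereal (h u)"] d by simp
    show "r \<le> d" if "\<And>u. u \<in> Z \<Longrightarrow> r \<le> h u" for r
      using INF_greatest[of Z "ereal r" "\<lambda>u. ereal (h u)"] that d by simp
  qed
qed


section \<open>The metric \<open>M\<close>\<close>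

text \<open>The \<open>M\<close>-norm is the Euclidean norm of \<open>(Q\<^sup>T w, w)\<close>.\<close>

definition K_map ::
  "real^'n^'m \<Rightarrow> real^'n^'p \<Rightarrow> (real^'m) \<times> (real^'p) \<Rightarrow> (real^'n) \<times> (real^'m) \<times> (real^'p)" where
  "K_map A B w = (adjoint (Q_map A B) w, w)"

lemma linear_Q_map: "linear (Q_map A B)"
  by (rule linearI) (auto simp: Q_map_def matrix_vector_right_distrib scaleR_matrix_vector_assoc
      matrix_vector_mult_scaleR)

lemmas linear_adjoint_Q_map = adjoint_linear[OF linear_Q_map]

lemma adjoint_Q_map_inner: "adjoint (Q_map A B) w \<bullet> x = w \<bullet> Q_map A B x"
  using adjoint_works[OF linear_Q_map, of x A B w] by (simp add: inner_commute)

lemma linear_K_map: "linear (K_map A B)"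
  unfolding K_map_def
  by (rule linearI) (simp_all add: linear_add[OF linear_adjoint_Q_map] linear_scale[OF linear_adjoint_Q_map])

lemma M_map_inner: "M_map A B v \<bullet> w = K_map A B v \<bullet> K_map A B w"
  by (simp add: M_map_def K_map_def inner_add_left inner_commute[of "Q_map A B _"]
      adjoint_Q_map_inner[symmetric]) (simp add: inner_commute)

lemma normM_eq: "normM A B w = norm (K_map A B w)"
  by (simp add: normM_def norm_eq_sqrt_inner M_map_inner[symmetric] inner_commute)

lemma normM_nonneg: "0 \<le> normM A B w"
  by (simp add: normM_eq)

lemma normM_minus: "normM A B (- w) = normM A B w"
  by (simp add: normM_eq linear_neg[OF linear_K_map])

lemma normM_minus_commute: "normM A B (v - w) = normM A B (w - v)"
  using normM_minus[of A B "v - w"] by simp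

lemma normM_triangle: "normM A B (u - w) \<le> normM A B (u - v) + normM A B (v - w)"
  unfolding normM_eq linear_diff[OF linear_K_map] by (metis dist_norm dist_triangle)

lemma norm_le_normM: "norm w \<le> normM A B w"
  unfolding normM_eq K_map_def by (metis norm_snd_le snd_conv)

lemma power2_normM:
  "(normM A B w)\<^sup>2 = (norm (adjoint (Q_map A B) w))\<^sup>2 + (norm (fst w))\<^sup>2 + (norm (snd w))\<^sup>2"
  unfolding normM_eq K_map_def by (cases w) (simp add: norm_Pair)

text \<open>\<open>normM\<close> attains its maximum over the unit sphere at some \<open>v\<close>,
  with square \<open>r\<close>. Cauchy-Schwarz for \<open>K_map\<close> bounds the norm of
  \<open>?M u\<close>, and at \<open>v\<close> the relations \<open>v \<bullet> ?M v = r\<close> and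
  \<open>norm (?M v) \<le> r\<close> force \<open>?M v = r *\<^sub>R v\<close>. No eigenvalue
  exceeds \<open>r\<close>, because the squared M-norm is the quadratic form of
  \<open>?M\<close>.\<close>

lemma max_eigenvalue_M_map:
  fixes A :: "real^'n^'m" and B :: "real^'n^'p"
  defines "l \<equiv> max_eigenvalue (M_map A B)"
  shows "1 \<le> l" and "(normM A B w)\<^sup>2 \<le> l * (norm w)\<^sup>2"
    and "(norm (M_map A B w))\<^sup>2 \<le> l * (normM A B w)\<^sup>2"
proof -
  let ?M = "M_map A B" and ?N = "normM A B"
  have cont: "continuous_on S ?N" for S
    unfolding normM_eq[abs_def]
    by (intro continuous_on_norm linear_continuous_on linear_K_map[THEN linear_conv_bounded_linear[THEN iffD1]])
  obtain e :: "(real^'m) \<times> (real^'p)" where "norm e = 1"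
    using vector_choose_size[of 1] zero_le_one by blast
  then have "sphere (0 :: (real^'m) \<times> (real^'p)) 1 \<noteq> {}" by auto
  then obtain v where v: "norm v = 1" "\<And>u. norm u = 1 \<Longrightarrow> ?N u \<le> ?N v"
    using continuous_attains_sup[OF compact_sphere _ cont] by (metis mem_sphere_0)
  define r where "r = (?N v)\<^sup>2"
  have r1: "1 \<le> r" using norm_le_normM[of v A B] v(1) by (simp add: r_def)
  have bound: "?N u \<le> ?N v * norm u" for u
  proof (cases "u = 0")
    case True then show ?thesis by (simp add: normM_def)
  next
    case False
    have "?N ((1 / norm u) *\<^sub>R u) = ?N u / norm u"
      by (simp add: normM_eq linear_scale[OF linear_K_map])
    with v(2)[of "(1 / norm u) *\<^sub>R u"] False show ?thesis by (simp add: field_simps)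
  qed
  have b1: "(?N u)\<^sup>2 \<le> r * (norm u)\<^sup>2" for u
    using power_mono[OF bound normM_nonneg, of u 2] by (simp add: r_def power_mult_distrib)
  have b2: "norm (?M u) \<le> ?N v * ?N u" for u
  proof (cases "?M u = 0")
    case True then show ?thesis by (simp add: normM_nonneg)
  next
    case False
    have "norm (?M u) * norm (?M u) = K_map A B u \<bullet> K_map A B (?M u)"
      using M_map_inner[of A B u "?M u"] by (simp add: dot_square_norm power2_eq_square)
    also have "\<dots> \<le> ?N u * ?N (?M u)" unfolding normM_eq by (rule norm_cauchy_schwarz)
    also have "\<dots> \<le> ?N u * (?N v * norm (?M u))" by (intro mult_left_mono bound normM_nonneg)
    finally show ?thesis using False by (simp add: mult.commute mult.left_commute)
  qed
  have "?M v = r *\<^sub>R v"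
  proof -
    have "v \<bullet> ?M v = r"
      using M_map_inner[of A B v v] by (simp add: r_def normM_eq inner_commute dot_square_norm)
    moreover have "norm (?M v) \<le> r" using b2[of v] by (simp add: r_def power2_eq_square)
    then have "?M v \<bullet> ?M v \<le> r\<^sup>2" by (simp add: dot_square_norm power_mono)
    moreover have "v \<bullet> v = 1" using v(1) by (simp add: dot_square_norm)
    ultimately have "(?M v - r *\<^sub>R v) \<bullet> (?M v - r *\<^sub>R v) \<le> 0"
      by (simp add: inner_diff_left inner_diff_right inner_commute power2_eq_square)
    then have "(norm (?M v - r *\<^sub>R v))\<^sup>2 \<le> 0" by (simp add: dot_square_norm)
    then show ?thesis by simp
  qed
  moreover have "r' \<le> r" if "u \<noteq> 0" "?M u = r' *\<^sub>R u" for r' u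
  proof -
    have "r' * (norm u)\<^sup>2 = (?N u)\<^sup>2"
      using M_map_inner[of A B u u] that(2) by (simp add: normM_eq dot_square_norm)
    with b1[of u] have "r' * (norm u)\<^sup>2 \<le> r * (norm u)\<^sup>2" by simp
    then show ?thesis using that(1) by simp
  qed
  moreover have "v \<noteq> 0" using v(1) by auto
  ultimately have l: "l = r"
    unfolding l_def max_eigenvalue_def by (intro Greatest_equality) blast+
  show "1 \<le> l" "(?N w)\<^sup>2 \<le> l * (norm w)\<^sup>2" using r1 b1 by (simp_all add: l)
  show "(norm (?M w))\<^sup>2 \<le> l * (?N w)\<^sup>2"
    using power_mono[OF b2 norm_ge_zero, of w 2] by (simp add: l r_def power_mult_distrib)
qed

section \<open>Coordinate projections and a completed square\<close>

lemma vec_part_add: "vec_part T (a + b) = vec_part T a + vec_part T b"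
  by (simp add: vec_part_def vec_eq_iff)

lemma vec_part_scaleR: "vec_part T (r *\<^sub>R a) = r *\<^sub>R vec_part T a"
  by (simp add: vec_part_def vec_eq_iff)

lemma vec_part_Compl: "vec_part T a + vec_part (- T) a = a"
  by (simp add: vec_part_def vec_eq_iff)

lemma norm_vec_part_le: "norm (vec_part T z) \<le> norm z"
  by (rule norm_le_componentwise_cart) (simp add: vec_part_def)

lemma inner_vec_part_left: "\<forall>i\<in>-T. u $ i = 0 \<Longrightarrow> vec_part T a \<bullet> u = a \<bullet> u"
  by (auto simp: inner_vec_def vec_part_def intro!: sum.cong)

lemma inner_vec_part_Compl: "\<forall>i\<in>-T. u $ i = 0 \<Longrightarrow> vec_part (- T) a \<bullet> u = 0"
  by (auto simp: inner_vec_def vec_part_def intro!: sum.neutral)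

text \<open>The two sides differ by \<open>c / 2\<close> times the squared norm of
  \<open>e + (1 / c) *\<^sub>R (b - a)\<close>. Weak duality uses this once for each of the blocks
  \<open>f\<close>, \<open>g\<close> and \<open>h\<close>.\<close>

lemma completed_square_le:
  fixes a b e :: "'a::real_inner"
  assumes "c > 0"
  shows "1 / (2 * c) * (norm b)\<^sup>2 + e \<bullet> a
    \<le> c / 2 * (norm (e + (1 / c) *\<^sub>R b))\<^sup>2 + 1 / (2 * c) * (norm (a - b))\<^sup>2"
proof -
  have expand: "c / 2 * (norm (e + (1 / c) *\<^sub>R d))\<^sup>2
      = c / 2 * (norm e)\<^sup>2 + e \<bullet> d + 1 / (2 * c) * (norm d)\<^sup>2" for d
    using assms unfolding power2_norm_eq_inner
    by (simp add: inner_add_left inner_add_right inner_commute distrib_left)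
  have "c / 2 * (norm (e + (1 / c) *\<^sub>R (b - a)))\<^sup>2 \<ge> 0" using assms by simp
  then show ?thesis
    unfolding expand by (simp add: inner_diff_right norm_minus_commute)
qed

section \<open>Duality and the proximal point step\<close>

text \<open>Finiteness of the conjugate of \<open>f\<close> on the whole space, later supplied by
  coercivity, is what makes the separating hyperplane in the subdifferential calculus
  non-vertical.\<close>

locale composite_dual =
  fixes f :: "real^'n \<Rightarrow> ereal" and g :: "real^'m \<Rightarrow> ereal"
    and A :: "real^'n^'m" and B :: "real^'n^'p::finite"
  assumes f: "proper_closed_convex f" and g: "proper_closed_convex g"
    and edom_f: "edom (conjugate_fun f) = UNIV" and edom_g: "edom (conjugate_fun g) \<noteq> {}"
begin

abbreviation "Qt \<equiv> adjoint (Q_map A B)"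
abbreviation "dom_g \<equiv> edom (conjugate_fun g)"

text \<open>\<open>gconj\<close> has the default value 0 outside \<open>dom_g\<close>, so statements
  about \<open>gconj\<close> and \<open>dual_obj\<close> are confined to that domain or to
  \<open>feasible T\<close>.\<close>

definition "fconj a = real_of_ereal (conjugate_fun f a)"
definition "gconj y = real_of_ereal (conjugate_fun g y)"
definition "dual_obj w = fconj (- Qt w) + gconj (fst w)"
definition feasible :: "'p set \<Rightarrow> ((real^'m) \<times> (real^'p)) set" where
  "feasible T = {w. fst w \<in> dom_g \<and> (\<forall>i\<in>-T. snd w $ i = 0)}"

lemma f_neq_MInf: "f x \<noteq> -\<infinity>" and g_neq_MInf: "g u \<noteq> -\<infinity>"
  using f g by (auto simp: proper_closed_convex_def)

lemma edom_f_ne: "edom f \<noteq> {}" and edom_g_ne: "edom g \<noteq> {}"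
  using f g by (auto simp: proper_closed_convex_def)

lemma conjugate_f: "conjugate_fun f a = ereal (fconj a)"
  using conjugate_fun_neq_MInf[of f a, OF f_neq_MInf edom_f_ne] edom_f
  unfolding fconj_def by (cases "conjugate_fun f a") (auto simp: edom_def set_eq_iff)

lemma conjugate_g_neq_MInf: "conjugate_fun g y \<noteq> -\<infinity>"
  by (rule conjugate_fun_neq_MInf[of g y, OF g_neq_MInf edom_g_ne])

lemma conjugate_g: "y \<in> dom_g \<Longrightarrow> conjugate_fun g y = ereal (gconj y)"
  using conjugate_g_neq_MInf[of y]
  unfolding gconj_def by (cases "conjugate_fun g y") (auto simp: edom_def)

lemma conjugate_g_infinite: "y \<notin> dom_g \<Longrightarrow> conjugate_fun g y = \<infinity>"
  by (auto simp: edom_def)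

lemma Xi_prox_eq:
  "fst w \<in> dom_g \<Longrightarrow> Xi_prox f g A B c w0 w = ereal (dual_obj w + 1 / (2 * c) * (normM A B (w - w0))\<^sup>2)"
  by (simp add: Xi_prox_def Xi_def dual_obj_def conjugate_f conjugate_g)

lemma Xi_prox_infinite: "fst w \<notin> dom_g \<Longrightarrow> Xi_prox f g A B c w0 w = \<infinity>"
  by (simp add: Xi_prox_def Xi_def conjugate_f conjugate_g_infinite)

lemma young_f: "f x \<le> ereal t \<Longrightarrow> s \<bullet> x - t \<le> fconj s"
  by (rule fenchel_young[of f x t s, OF f_neq_MInf]) (simp_all add: conjugate_f)

lemma young_g: "g u \<le> ereal t \<Longrightarrow> y \<in> dom_g \<Longrightarrow> y \<bullet> u - t \<le> gconj y"
  by (rule fenchel_young[of g u t y, OF g_neq_MInf]) (simp_all add: conjugate_g)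

lemma convex_fconj: "convex_on UNIV fconj"
  using convex_on_real_of_ereal[of "conjugate_fun f", OF conjugate_fun_neq_MInf[OF f_neq_MInf edom_f_ne]
      convex_epi_conjugate_fun[of f, OF f_neq_MInf]] edom_f
  by (simp add: fconj_def[abs_def])

lemma convex_gconj: "convex_on dom_g gconj"
  using convex_on_real_of_ereal[of "conjugate_fun g", OF conjugate_g_neq_MInf
      convex_epi_conjugate_fun[of g, OF g_neq_MInf]]
  by (simp add: gconj_def[abs_def])

lemma linear_neg_Qt: "linear (\<lambda>w. - Qt w)"
  by (intro linear_compose_neg linear_adjoint_Q_map)

lemma continuous_fconj_Qt: "continuous_on S (\<lambda>w. fconj (- Qt w))"
proof -
  have "continuous_on UNIV fconj" using convex_on_continuous[OF open_UNIV convex_fconj] .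
  moreover have "continuous_on S (\<lambda>w. - Qt w)"
    using linear_continuous_on linear_neg_Qt linear_conv_bounded_linear by blast
  ultimately show ?thesis using continuous_on_compose2[of UNIV fconj S "\<lambda>w. - Qt w"] by simp
qed

lemma convex_feasible: "convex (feasible T)"
proof (rule convexI)
  fix v w :: "(real^'m) \<times> (real^'p)" and r s :: real
  assume "v \<in> feasible T" "w \<in> feasible T" "0 \<le> r" "0 \<le> s" "r + s = 1"
  then show "r *\<^sub>R v + s *\<^sub>R w \<in> feasible T"
    using convexD[OF convex_on_imp_convex[OF convex_gconj], of "fst v" "fst w" r s]
    by (auto simp: feasible_def)
qed

lemma convex_gconj_feasible: "convex_on (feasible T) (\<lambda>w. gconj (fst w))"
  using convex_gconj convex_feasible[of T] unfolding convex_on_def feasible_def by auto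

lemma convex_dual_obj: "convex_on (feasible T) dual_obj"
proof -
  have "convex_on (feasible T) (\<lambda>w. fconj (- Qt w))"
  proof -
    have "fconj (- Qt (r *\<^sub>R v + s *\<^sub>R w)) \<le> r * fconj (- Qt v) + s * fconj (- Qt w)"
      if "0 \<le> r" "0 \<le> s" "r + s = 1" for r s v w
    proof -
      have "- Qt (r *\<^sub>R v + s *\<^sub>R w) = r *\<^sub>R (- Qt v) + s *\<^sub>R (- Qt w)"
        by (simp add: linear_add[OF linear_adjoint_Q_map] linear_scale[OF linear_adjoint_Q_map])
      then show ?thesis using convex_fconj that unfolding convex_on_def by (metis UNIV_I)
    qed
    then show ?thesis using convex_feasible[of T] unfolding convex_on_def by auto
  qed
  then show ?thesis unfolding dual_obj_def[abs_def]
    by (intro convex_on_add convex_gconj_feasible)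
qed

text \<open>Fenchel-Young at one point of each primal domain. The minorant serves both the existence
  of proximal points and the lower bound on the penalized values.\<close>

lemma dual_obj_affine_minorant:
  obtains a b where "\<And>w. fst w \<in> dom_g \<Longrightarrow> a \<bullet> w + b \<le> dual_obj w"
proof -
  obtain x0 t0 where x0: "f x0 \<le> ereal t0"
    using edom_f_ne by (auto simp: edom_def) (metis ereal_less_eq(1) ereal_cases f_neq_MInf less_irrefl order.refl)
  obtain u0 t1 where u0: "g u0 \<le> ereal t1"
    using edom_g_ne by (auto simp: edom_def) (metis ereal_less_eq(1) ereal_cases g_neq_MInf less_irrefl order.refl)
  have "((u0, 0) - Q_map A B x0) \<bullet> w + (- t0 - t1) \<le> dual_obj w" if "fst w \<in> dom_g" for w
    using young_f[OF x0, of "- Qt w"] young_g[OF u0 that]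
    by (cases w) (simp add: dual_obj_def adjoint_Q_map_inner inner_diff_left inner_diff_right
        inner_commute[of u0] inner_commute[of "Q_map A B x0"])
  then show thesis using that by blast
qed

text \<open>\<open>fconj\<close> is continuous, so subtracting it from the height turns this set
  into a continuous preimage of the closed epigraph of the conjugate of \<open>g\<close>, cut by a
  closed subspace.\<close>

lemma closed_epi_dual_obj: "closed {(w, t). w \<in> feasible T \<and> dual_obj w \<le> t}"
proof -
  have "closed ((\<lambda>p. (fst (fst p), snd p - fconj (- Qt (fst p)))) -` epi (conjugate_fun g))"
    using continuous_on_compose2[OF continuous_fconj_Qt[of UNIV] continuous_on_fst[OF continuous_on_id]]
    by (intro closed_vimage closed_epi_conjugate_fun continuous_intros g_neq_MInf) auto
  moreover have "closed {p :: ((real^'m) \<times> (real^'p)) \<times> real. \<forall>i\<in>-T. snd (fst p) $ i = 0}"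
  proof -
    have "closed (\<Inter>i\<in>-T. {p :: ((real^'m) \<times> (real^'p)) \<times> real. snd (fst p) $ i = 0})"
      by (intro closed_INT ballI closed_Collect_eq continuous_intros)
    moreover have "(\<Inter>i\<in>-T. {p :: ((real^'m) \<times> (real^'p)) \<times> real. snd (fst p) $ i = 0})
        = {p. \<forall>i\<in>-T. snd (fst p) $ i = 0}" by auto
    ultimately show ?thesis by simp
  qed
  ultimately have "closed ((\<lambda>p. (fst (fst p), snd p - fconj (- Qt (fst p)))) -` epi (conjugate_fun g)
      \<inter> {p. \<forall>i\<in>-T. snd (fst p) $ i = 0})" by (rule closed_Int)
  also have "\<dots> = {(w, t). w \<in> feasible T \<and> dual_obj w \<le> t}"
  proof -
    have "conjugate_fun g y \<le> ereal t \<longleftrightarrow> y \<in> dom_g \<and> gconj y \<le> t" for y t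
      by (cases "y \<in> dom_g") (auto simp: conjugate_g conjugate_g_infinite)
    then show ?thesis by (auto simp: feasible_def epi_def dual_obj_def algebra_simps)
  qed
  finally show ?thesis .
qed

section \<open>Subgradients of the dual objective and the exact proximal step\<close>

lemma S_map_subgradient:
  assumes "s \<in> S_map f g A B T w"
  shows "w \<in> feasible T" and "v \<in> feasible T \<Longrightarrow> dual_obj w + s \<bullet> (v - w) \<le> dual_obj v"
proof -
  from assms obtain \<xi> u z where z: "\<forall>i\<in>-T. snd w $ i = 0" and s: "s = - Q_map A B \<xi> + (u, z)"
    and \<xi>: "\<xi> \<in> subdifferential (conjugate_fun f) (- Qt w)"
    and u: "u \<in> subdifferential (conjugate_fun g) (fst w)" and z0: "\<forall>i\<in>T. z $ i = 0"
    unfolding S_map_def by (auto split: if_splits)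
  show w: "w \<in> feasible T" using z u by (simp add: feasible_def subdifferential_def)
  assume v: "v \<in> feasible T"
  have "fconj (- Qt w) + \<xi> \<bullet> (- Qt v - - Qt w) \<le> fconj (- Qt v)"
  proof -
    have "conjugate_fun f (- Qt w) + ereal (\<xi> \<bullet> (- Qt v - - Qt w)) \<le> conjugate_fun f (- Qt v)"
      using \<xi> unfolding subdifferential_def by blast
    then show ?thesis by (simp add: conjugate_f)
  qed
  moreover have "conjugate_fun g (fst w) + ereal (u \<bullet> (fst v - fst w)) \<le> conjugate_fun g (fst v)"
    using u by (simp add: subdifferential_def)
  then have "gconj (fst w) + u \<bullet> (fst v - fst w) \<le> gconj (fst v)"
    using v w by (simp add: feasible_def conjugate_g)
  \<comment> \<open>\<open>z\<close> vanishes on \<open>T\<close>, while \<open>v\<close> and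
    \<open>w\<close> both vanish off \<open>T\<close>, so \<open>z\<close> is normal to the
    constraint subspace.\<close>
  moreover have "z \<bullet> (snd v - snd w) = 0"
    unfolding inner_vec_def using v w z0 by (intro sum.neutral) (auto simp: feasible_def)
  moreover have "\<xi> \<bullet> (- Qt v - - Qt w) = - Q_map A B \<xi> \<bullet> (v - w)"
    by (simp add: inner_diff_right inner_commute[of \<xi>] adjoint_Q_map_inner inner_commute[of _ "Q_map A B \<xi>"])
  ultimately show "dual_obj w + s \<bullet> (v - w) \<le> dual_obj v"
    by (simp add: s dual_obj_def inner_add_left inner_diff_left inner_prod_def)
qed

lemma S_map_prox_point:
  assumes c: "c > 0"
  obtains w1 where "- (1 / c) *\<^sub>R M_map A B (w1 - w0) \<in> S_map f g A B T w1"
proof -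
  let ?C = "feasible T" and ?K = "K_map A B"
  obtain a b where ab: "\<And>w. fst w \<in> dom_g \<Longrightarrow> a \<bullet> w + b \<le> dual_obj w"
    using dual_obj_affine_minorant by blast
  obtain y0 where "y0 \<in> dom_g" using edom_g by auto
  then have "(y0, 0) \<in> ?C" by (simp add: feasible_def)
  moreover have "norm w \<le> norm (?K w)" for w using norm_le_normM[of w A B] by (simp add: normM_eq)
  moreover have "a \<bullet> w + b \<le> dual_obj w" if "w \<in> ?C" for w
    using ab that by (simp add: feasible_def)
  ultimately obtain w1 where w1: "w1 \<in> ?C"
    and min: "\<And>w. w \<in> ?C \<Longrightarrow> dual_obj w1 + 1 / (2 * c) * (norm (?K (w1 - w0)))\<^sup>2
                      \<le> dual_obj w + 1 / (2 * c) * (norm (?K (w - w0)))\<^sup>2"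
    using prox_minimizer_exists[OF linear_K_map[of A B] _ closed_epi_dual_obj[of T] _ _ c, of "(y0, 0)" a b w0] by blast
  define s where "s = - (1 / c) *\<^sub>R M_map A B (w1 - w0)"
  \<comment> \<open>With \<open>gconj\<close> tilted by \<open>s\<close>, the variational inequality
    says that \<open>w1\<close> minimizes \<open>fconj (- Qt w) + h w\<close> over
    \<open>?C\<close>. Fenchel duality then splits off \<xi>, and the remaining inequality
    \<open>key\<close> yields \<open>u\<close> and \<open>v\<close>.\<close>
  define h where "h w = gconj (fst w) - s \<bullet> w" for w
  have "fconj (- Qt w1) + h w1 \<le> fconj (- Qt w) + h w" if "w \<in> ?C" for w
    using prox_minimizer_variational[OF linear_K_map convex_dual_obj c w1 that min]
    by (simp add: h_def s_def dual_obj_def M_map_inner[symmetric] inner_diff_right)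
      (simp add: algebra_simps diff_divide_distrib)
  moreover have "convex_on ?C h"
    unfolding h_def
  proof (rule convex_on_diff[OF convex_gconj_feasible])
    show "concave_on ?C ((\<bullet>) s)"
      unfolding concave_on_def convex_on_def using convex_feasible[of T] by (auto simp: inner_add_right)
  qed
  ultimately obtain \<xi> where \<xi>: "\<And>a. fconj (- Qt w1) + \<xi> \<bullet> (a - - Qt w1) \<le> fconj a"
    and h: "\<And>w. w \<in> ?C \<Longrightarrow> h w1 - \<xi> \<bullet> (- Qt w - - Qt w1) \<le> h w"
    using fenchel_duality_subgradient[OF convex_fconj linear_neg_Qt _ w1, of h] by blast
  obtain u v where uv: "s + Q_map A B \<xi> = (u, v)" by (cases "s + Q_map A B \<xi>")
  have key: "gconj (fst w1) + u \<bullet> (fst w - fst w1) + v \<bullet> (snd w - snd w1) \<le> gconj (fst w)"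
    if "w \<in> ?C" for w
  proof -
    have "- (\<xi> \<bullet> (- Qt w - - Qt w1)) = Q_map A B \<xi> \<bullet> (w - w1)"
      by (simp add: inner_diff_right inner_commute[of \<xi>] adjoint_Q_map_inner inner_commute[of _ "Q_map A B \<xi>"])
    then have "gconj (fst w1) + (s + Q_map A B \<xi>) \<bullet> (w - w1) \<le> gconj (fst w)"
      using h[OF that] by (simp add: h_def inner_add_left inner_diff_right)
    then show ?thesis unfolding uv by (simp add: inner_prod_def)
  qed
  have "\<xi> \<in> subdifferential (conjugate_fun f) (- Qt w1)"
    using \<xi> edom_f by (simp add: subdifferential_def conjugate_f)
  \<comment> \<open>Only the first block is varied, with the second kept at
    \<open>snd w1\<close>.\<close>
  moreover have "u \<in> subdifferential (conjugate_fun g) (fst w1)"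
  proof -
    have "conjugate_fun g (fst w1) + ereal (u \<bullet> (y - fst w1)) \<le> conjugate_fun g y" for y
    proof (cases "y \<in> dom_g")
      case True
      then show ?thesis using key[of "(y, snd w1)"] w1 by (simp add: feasible_def conjugate_g)
    qed (simp add: conjugate_g_infinite)
    then show ?thesis using w1 by (simp add: subdifferential_def feasible_def)
  qed
  \<comment> \<open>Coordinates in \<open>T\<close> are free in both directions, so the slope along
    each of them must vanish.\<close>
  moreover have "\<forall>i\<in>T. v $ i = 0"
  proof
    fix i assume i: "i \<in> T"
    have "v \<bullet> (r *\<^sub>R axis i 1) \<le> 0" for r
    proof -
      have "(fst w1, snd w1 + r *\<^sub>R axis i 1) \<in> ?C" using w1 i by (auto simp: feasible_def axis_def)
      from key[OF this] show ?thesis by simp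
    qed
    from this[of 1] this[of "-1"] show "v $ i = 0" by (simp add: inner_axis)
  qed
  moreover have "s = - Q_map A B \<xi> + (u, v)" using uv by (simp add: algebra_simps)
  moreover have "\<forall>i\<in>-T. snd w1 $ i = 0" using w1 by (simp add: feasible_def)
  ultimately have "s \<in> S_map f g A B T w1"
    unfolding S_map_def by auto
  then show thesis using that s_def by blast
qed

text \<open>Strong convexity at the proximal point: expanding the squared M-norm around
  \<open>w1\<close> produces a cross term that cancels the linear term of the subgradient
  inequality.\<close>

lemma prox_point_quadratic_growth:
  assumes "- (1 / c) *\<^sub>R M_map A B (w1 - w0) \<in> S_map f g A B T w1" and "w \<in> feasible T"
  shows "dual_obj w1 + 1 / (2 * c) * (normM A B (w1 - w0))\<^sup>2 + 1 / (2 * c) * (normM A B (w - w1))\<^sup>2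
    \<le> dual_obj w + 1 / (2 * c) * (normM A B (w - w0))\<^sup>2"
proof -
  have "dual_obj w1 - 1 / c * (K_map A B (w1 - w0) \<bullet> K_map A B (w - w1)) \<le> dual_obj w"
    using S_map_subgradient(2)[OF assms] by (simp add: M_map_inner)
  moreover have "K_map A B (w - w0) = K_map A B (w1 - w0) + K_map A B (w - w1)"
    by (simp add: linear_add[OF linear_K_map, symmetric])
  then have "(normM A B (w - w0))\<^sup>2 = (normM A B (w1 - w0))\<^sup>2 + (normM A B (w - w1))\<^sup>2
      + 2 * (K_map A B (w1 - w0) \<bullet> K_map A B (w - w1))"
    by (simp add: normM_eq power2_norm_eq_inner inner_add_left inner_add_right inner_commute)
  then have "1 / (2 * c) * (normM A B (w - w0))\<^sup>2 = 1 / (2 * c) * (normM A B (w1 - w0))\<^sup>2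
      + 1 / (2 * c) * (normM A B (w - w1))\<^sup>2 + 1 / c * (K_map A B (w1 - w0) \<bullet> K_map A B (w - w1))"
    by (simp add: algebra_simps add_divide_distrib)
  ultimately show ?thesis by linarith
qed

text \<open>Fenchel-Young for \<open>f\<close> and \<open>g\<close> and a completed square in each
  of the three blocks; the terms linear in \<open>x\<close> cancel because
  \<open>Qt u \<bullet> x\<close> splits into the products with \<open>A *v x\<close> and
  \<open>B *v x\<close>.\<close>

lemma weak_duality:
  assumes c: "c > 0" and u: "u \<in> feasible T"
  shows "- (dual_obj u + 1 / (2 * c) * (normM A B (u - wk))\<^sup>2) \<le> Psi_prox f g A B c T wk x"
proof -
  let ?q = "1 / (2 * c)"
  have uD: "fst u \<in> dom_g" and u0: "\<forall>i\<in>-T. snd u $ i = 0" using u by (auto simp: feasible_def)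
  have "?q * (norm (Qt wk))\<^sup>2 - fconj (- Qt u) - ?q * (norm (Qt (u - wk)))\<^sup>2 - Qt u \<bullet> x
      \<le> real_of_ereal (moreau_env (1 / c) f (x - (1 / c) *\<^sub>R Qt wk))"
  proof (rule le_real_of_moreau_env[of f, OF f_neq_MInf edom_f_ne])
    fix x' t assume "f x' \<le> ereal t"
    from young_f[OF this, of "- Qt u"] completed_square_le[OF c, of "Qt wk" "x' - x" "Qt u"]
    show "?q * (norm (Qt wk))\<^sup>2 - fconj (- Qt u) - ?q * (norm (Qt (u - wk)))\<^sup>2 - Qt u \<bullet> x
        \<le> 1 / (2 * (1 / c)) * (norm (x' - (x - (1 / c) *\<^sub>R Qt wk)))\<^sup>2 + t"
      by (simp add: linear_diff[OF linear_adjoint_Q_map] algebra_simps inner_diff_left inner_commute)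
  qed
  then have 1: "- fconj (- Qt u) - ?q * (norm (Qt (u - wk)))\<^sup>2 - Qt u \<bullet> x \<le> f_prox f A B c wk x"
    by (simp add: f_prox_def)
  have "?q * (norm (fst wk))\<^sup>2 - gconj (fst u) - ?q * (norm (fst (u - wk)))\<^sup>2 + fst u \<bullet> (A *v x)
      \<le> real_of_ereal (moreau_env (1 / c) g (A *v x + (1 / c) *\<^sub>R fst wk))"
  proof (rule le_real_of_moreau_env[of g, OF g_neq_MInf edom_g_ne])
    fix v t assume "g v \<le> ereal t"
    from young_g[OF this uD] completed_square_le[OF c, of "- fst wk" "v - A *v x" "- fst u"]
    show "?q * (norm (fst wk))\<^sup>2 - gconj (fst u) - ?q * (norm (fst (u - wk)))\<^sup>2 + fst u \<bullet> (A *v x)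
        \<le> 1 / (2 * (1 / c)) * (norm (v - (A *v x + (1 / c) *\<^sub>R fst wk)))\<^sup>2 + t"
      by (simp add: algebra_simps inner_diff_left inner_commute norm_minus_commute)
  qed
  then have 2: "- gconj (fst u) - ?q * (norm (fst (u - wk)))\<^sup>2 + fst u \<bullet> (A *v x) \<le> g_prox g c (fst wk) (A *v x)"
    by (simp add: g_prox_def)
  \<comment> \<open>\<open>h_prox\<close> sees only coordinates in \<open>T\<close> but subtracts
    the full norm of \<open>snd wk\<close>. The part \<open>n\<close> off \<open>T\<close>
    contributes the same amount to the distance from \<open>u\<close>, which vanishes there.\<close>
  have 3: "- ?q * (norm (snd (u - wk)))\<^sup>2 + snd u \<bullet> (B *v x) \<le> h_prox c T (snd wk) (B *v x)"
  proof -
    define p where "p = vec_part T (snd wk)"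
    define n where "n = vec_part (- T) (snd wk)"
    have wk: "snd wk = p + n" by (simp add: p_def n_def vec_part_Compl)
    have "p \<bullet> n = 0" by (auto simp: p_def n_def inner_vec_def vec_part_def intro!: sum.neutral)
    moreover have "snd u \<bullet> n = 0" using inner_vec_part_Compl[OF u0] by (simp add: n_def inner_commute)
    ultimately have "(norm (snd wk))\<^sup>2 = (norm p)\<^sup>2 + (norm n)\<^sup>2"
      "(norm (snd (u - wk)))\<^sup>2 = (norm (snd u - p))\<^sup>2 + (norm n)\<^sup>2"
      by (simp_all add: wk power2_norm_eq_inner inner_add_left inner_add_right inner_diff_left
          inner_diff_right inner_commute)
    then show ?thesis
      using completed_square_le[OF c, of p "vec_part T (B *v x)" "snd u"] inner_vec_part_left[OF u0, of "B *v x"]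
      by (simp add: h_prox_def vec_part_add vec_part_scaleR p_def[symmetric] inner_commute algebra_simps add_divide_distrib)
  qed
  have "Qt u \<bullet> x = fst u \<bullet> (A *v x) + snd u \<bullet> (B *v x)"
    by (cases u) (simp add: adjoint_Q_map_inner Q_map_def)
  moreover have "?q * (normM A B (u - wk))\<^sup>2 = ?q * (norm (Qt (u - wk)))\<^sup>2
      + ?q * (norm (fst (u - wk)))\<^sup>2 + ?q * (norm (snd (u - wk)))\<^sup>2"
    unfolding power2_normM by (simp add: distrib_left)
  ultimately show ?thesis using 1 2 3 unfolding Psi_prox_def dual_obj_def by linarith
qed

lemma duality_gap_finite:
  assumes "duality_gap f g A B c T w0 x w \<le> ereal r"
  shows "fst w \<in> dom_g"
  using assms Xi_prox_infinite[of w c w0] by (cases "fst w \<in> dom_g") (auto simp: duality_gap_def)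

text \<open>By weak duality the gap bounds the excess of the proximal dual value at \<open>w\<close>
  over its minimum at \<open>w1\<close>; quadratic growth turns this excess into a distance.\<close>

lemma dist_prox_point_le_gap:
  assumes c: "c > 0" and w1: "- (1 / c) *\<^sub>R M_map A B (w1 - w0) \<in> S_map f g A B T w1"
    and gap: "duality_gap f g A B c T w0 x w \<le> ereal (r / (2 * c))"
    and w: "\<forall>i\<in>-T. snd w $ i = 0"
  shows "(normM A B (w - w1))\<^sup>2 \<le> r"
    and "dual_obj w + 1 / (2 * c) * (normM A B (w - w0))\<^sup>2
      \<le> dual_obj w1 + 1 / (2 * c) * (normM A B (w1 - w0))\<^sup>2 + r / (2 * c)"
proof -
  have wD: "fst w \<in> dom_g" using duality_gap_finite[OF gap] .
  then have wf: "w \<in> feasible T" using w by (simp add: feasible_def)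
  have "Psi_prox f g A B c T w0 x + (dual_obj w + 1 / (2 * c) * (normM A B (w - w0))\<^sup>2) \<le> r / (2 * c)"
    using gap by (simp add: duality_gap_def Xi_prox_eq[OF wD])
  then show *: "dual_obj w + 1 / (2 * c) * (normM A B (w - w0))\<^sup>2
      \<le> dual_obj w1 + 1 / (2 * c) * (normM A B (w1 - w0))\<^sup>2 + r / (2 * c)"
    using weak_duality[OF c S_map_subgradient(1)[OF w1], of w0 x] by linarith
  with prox_point_quadratic_growth[OF w1 wf]
  have "1 / (2 * c) * (normM A B (w - w1))\<^sup>2 \<le> r / (2 * c)" by linarith
  then show "(normM A B (w - w1))\<^sup>2 \<le> r" using c by (simp add: field_simps)
qed

end

section \<open>Contraction of the inexact proximal step\<close>

context composite_dual
begin

lemma inexact_prox_step_rate: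
  assumes c: "c > 0" and \<kappa>: "\<kappa> > 0" and e: "0 \<le> e" "e < 1"
    and gap: "duality_gap f g A B c T w0 x w \<le> ereal (e\<^sup>2 / (2 * c) * (normM A B (w - w0))\<^sup>2)"
    and w: "\<forall>i\<in>-T. snd w $ i = 0"
    and eb: "error_bound (S_map f g A B T) (S_zeros f g A B T) \<nu> \<kappa>"
    and near: "u0 \<in> S_zeros f g A B T" "normM A B (w0 - u0) \<le> \<nu>"
  shows "distM_set A B w (S_zeros f g A B T)
    \<le> ereal (rate \<kappa> (max_eigenvalue (M_map A B)) c e) * distM_set A B w0 (S_zeros f g A B T)"
proof -
  let ?N = "normM A B" and ?Z = "S_zeros f g A B T"
  define lam where "lam = max_eigenvalue (M_map A B)"
  note lam = max_eigenvalue_M_map[of A B, folded lam_def]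
  obtain w1 where w1: "- (1 / c) *\<^sub>R M_map A B (w1 - w0) \<in> S_map f g A B T w1"
    using S_map_prox_point[OF c] by blast
  define n where "n = ?N (w1 - w0)"
  have "?Z \<noteq> {}" using near(1) by auto
  note real_dist = INF_ereal_eq_real[OF this, of "\<lambda>u. ?N (v - u)" for v, OF normM_nonneg]
  \<comment> \<open>\<open>d0\<close>, \<open>d1\<close> and \<open>d\<close> are the M-distances of
    the old point, the exact point \<open>w1\<close> and the inexact point \<open>w\<close>;
    \<open>e1\<close> is the Euclidean distance of \<open>w1\<close>, in which the error bound is
    stated.\<close>
  obtain d0 where d0: "0 \<le> d0" "distM_set A B w0 ?Z = ereal d0" "\<And>r. (\<And>u. u \<in> ?Z \<Longrightarrow> r \<le> ?N (w0 - u)) \<Longrightarrow> r \<le> d0"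
    using real_dist[of w0] unfolding distM_set_def by metis
  obtain d1 where d1: "0 \<le> d1" "\<And>u. u \<in> ?Z \<Longrightarrow> d1 \<le> ?N (w1 - u)"
      "\<And>r. (\<And>u. u \<in> ?Z \<Longrightarrow> r \<le> ?N (w1 - u)) \<Longrightarrow> r \<le> d1"
    using real_dist[of w1] by metis
  obtain d where d: "distM_set A B w ?Z = ereal d" "\<And>u. u \<in> ?Z \<Longrightarrow> d \<le> ?N (w - u)"
    using real_dist[of w] unfolding distM_set_def by metis
  obtain e1 where e1: "edist_set w1 ?Z = ereal e1" "\<And>u. u \<in> ?Z \<Longrightarrow> e1 \<le> norm (w1 - u)"
      "\<And>r. (\<And>u. u \<in> ?Z \<Longrightarrow> r \<le> norm (w1 - u)) \<Longrightarrow> r \<le> e1"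
    using INF_ereal_eq_real[OF \<open>?Z \<noteq> {}\<close>, of "\<lambda>u. norm (w1 - u)"] unfolding edist_set_def
    by (metis norm_ge_zero)
  \<comment> \<open>A zero \<open>u\<close> minimizes \<open>dual_obj\<close> over the feasible set,
    so the function values drop out of quadratic growth at \<open>u\<close>.\<close>
  have firm: "(?N (w1 - u))\<^sup>2 + n\<^sup>2 \<le> (?N (w0 - u))\<^sup>2" if "u \<in> ?Z" for u
  proof -
    have u0: "0 \<in> S_map f g A B T u" using that by (simp add: S_zeros_def)
    have "dual_obj u \<le> dual_obj w1" using S_map_subgradient(2)[OF u0 S_map_subgradient(1)[OF w1]] by simp
    with prox_point_quadratic_growth[OF w1 S_map_subgradient(1)[OF u0]]
    have "1 / (2 * c) * n\<^sup>2 + 1 / (2 * c) * (?N (u - w1))\<^sup>2 \<le> 1 / (2 * c) * (?N (u - w0))\<^sup>2"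
      unfolding n_def by linarith
    then have "1 / (2 * c) * (n\<^sup>2 + (?N (u - w1))\<^sup>2) \<le> 1 / (2 * c) * (?N (u - w0))\<^sup>2"
      by (simp only: distrib_left)
    moreover have "0 < 1 / (2 * c)" using c by simp
    ultimately have "n\<^sup>2 + (?N (u - w1))\<^sup>2 \<le> (?N (u - w0))\<^sup>2" by (rule mult_left_le_imp_le)
    then show ?thesis by (simp add: normM_minus_commute[of A B u])
  qed
  have "sqrt (d1\<^sup>2 + n\<^sup>2) \<le> d0"
  proof (rule d0(3))
    fix u assume u: "u \<in> ?Z"
    have "d1\<^sup>2 + n\<^sup>2 \<le> (?N (w0 - u))\<^sup>2"
      using firm[OF u] power_mono[OF d1(2)[OF u] d1(1), of 2] by linarith
    then show "sqrt (d1\<^sup>2 + n\<^sup>2) \<le> ?N (w0 - u)" by (simp add: real_le_lsqrt normM_nonneg)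
  qed
  then have pyth: "d1\<^sup>2 + n\<^sup>2 \<le> d0\<^sup>2"
    using power_mono[of "sqrt (d1\<^sup>2 + n\<^sup>2)" d0 2] by simp
  have "n \<le> d0"
    by (rule power2_le_imp_le[OF _ d0(1)]) (use pyth zero_le_power2[of d1] in linarith)
  \<comment> \<open>By \<open>firm\<close> the exact step does not move away from \<open>u0\<close>,
    so the error bound applies at \<open>w1\<close>.\<close>
  have "?N (w1 - u0) \<le> \<nu>"
  proof -
    have "?N (w1 - u0) \<le> ?N (w0 - u0)"
      by (rule power2_le_imp_le[OF _ normM_nonneg])
        (use firm[OF near(1)] zero_le_power2[of n] in linarith)
    then show ?thesis using near(2) by linarith
  qed
  then have "e1 \<le> \<nu>" using e1(2)[OF near(1)] norm_le_normM[of "w1 - u0" A B] by linarith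
  then have "ereal e1 \<le> ereal \<kappa> * edist_set 0 (S_map f g A B T w1)"
    using eb e1(1) unfolding error_bound_def by (metis ereal_less_eq(3))
  also have "\<dots> \<le> ereal \<kappa> * ereal (norm (0 - (- (1 / c) *\<^sub>R M_map A B (w1 - w0))))"
    unfolding edist_set_def using \<kappa> by (intro ereal_mult_left_mono INF_lower w1) auto
  finally have "e1 \<le> \<kappa> * (1 / c * norm (M_map A B (w1 - w0)))" using c by simp
  also have "norm (M_map A B (w1 - w0)) \<le> sqrt lam * n"
    using real_le_rsqrt[OF lam(3)[of "w1 - w0"]] by (simp add: real_sqrt_mult n_def normM_nonneg)
  finally have e1_le: "e1 \<le> \<kappa> * (1 / c * (sqrt lam * n))" using c \<kappa> by (simp add: mult_left_mono divide_right_mono)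
  \<comment> \<open>One factor \<open>sqrt lam\<close> comes from this comparison of norms, the
    other from the bound on \<open>M_map A B (w1 - w0)\<close>; together they give the
    \<open>lam\<close> of the rate.\<close>
  have "d1 / sqrt lam \<le> e1"
  proof (rule e1(3))
    fix u assume "u \<in> ?Z"
    have "?N (w1 - u) \<le> sqrt lam * norm (w1 - u)"
      using real_le_rsqrt[OF lam(2)[of "w1 - u"]] by (simp add: real_sqrt_mult)
    with d1(2)[OF \<open>u \<in> ?Z\<close>] show "d1 / sqrt lam \<le> norm (w1 - u)"
      using lam(1) by (simp add: field_simps)
  qed
  then have "d1 \<le> sqrt lam * (\<kappa> * (1 / c * (sqrt lam * n)))"
  proof -
    have "0 < sqrt lam" using lam(1) by simp
    then have "d1 = sqrt lam * (d1 / sqrt lam)" by simp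
    also have "\<dots> \<le> sqrt lam * (\<kappa> * (1 / c * (sqrt lam * n)))"
      using \<open>0 < sqrt lam\<close> \<open>d1 / sqrt lam \<le> e1\<close> e1_le by (intro mult_left_mono) linarith+
    finally show ?thesis .
  qed
  also have "\<dots> = (sqrt lam * sqrt lam) * \<kappa> * n / c" by (simp add: algebra_simps)
  also have "\<dots> = \<kappa> * lam * n / c" using lam(1) by simp
  finally have "c * d1 \<le> \<kappa> * lam * n" using c by (simp add: field_simps)
  then have "(c * d1)\<^sup>2 \<le> (\<kappa> * lam * n)\<^sup>2" using c d1(1) by (intro power_mono) auto
  \<comment> \<open>\<open>pyth\<close> eliminates the step length \<open>n\<close>, leaving an
    inequality between \<open>d0\<close> and \<open>d1\<close> only.\<close>
  also have "\<dots> \<le> (\<kappa> * lam)\<^sup>2 * (d0\<^sup>2 - d1\<^sup>2)"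
    using pyth by (simp add: power_mult_distrib mult_left_mono)
  finally have "(c\<^sup>2 + \<kappa>\<^sup>2 * lam\<^sup>2) * d1\<^sup>2 \<le> (\<kappa> * lam * d0)\<^sup>2"
    by (simp add: power_mult_distrib algebra_simps)
  then have "sqrt ((c\<^sup>2 + \<kappa>\<^sup>2 * lam\<^sup>2) * d1\<^sup>2) \<le> \<kappa> * lam * d0"
    using \<kappa> lam(1) d0(1) by (intro real_le_lsqrt) auto
  then have "sqrt (c\<^sup>2 + \<kappa>\<^sup>2 * lam\<^sup>2) * d1 \<le> \<kappa> * lam * d0"
    using d1(1) by (simp add: real_sqrt_mult)
  moreover have "0 < sqrt (c\<^sup>2 + \<kappa>\<^sup>2 * lam\<^sup>2)" using c by (simp add: add_pos_nonneg)
  ultimately have contraction: "d1 \<le> limit_rate \<kappa> lam c * d0"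
    by (simp add: limit_rate_def field_simps)
  have "e\<^sup>2 / (2 * c) * (?N (w - w0))\<^sup>2 = (e * ?N (w - w0))\<^sup>2 / (2 * c)"
    by (simp add: power_mult_distrib)
  with gap have "duality_gap f g A B c T w0 x w \<le> ereal ((e * ?N (w - w0))\<^sup>2 / (2 * c))" by (simp only:)
  from dist_prox_point_le_gap(1)[OF c w1 this w] have inexact: "?N (w - w1) \<le> e * ?N (w - w0)"
    using mult_nonneg_nonneg[OF e(1) normM_nonneg] by (rule power2_le_imp_le)
  \<comment> \<open>The triangle inequality is solved for the distance from \<open>w1\<close> to
    \<open>u\<close>, so that the bound holds for every \<open>u\<close> and passes to the infimum
    \<open>d1\<close>.\<close>
  have "((1 - e) * d - e * d0) / (1 + e) \<le> d1"
  proof (rule d1(3))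
    fix u assume u: "u \<in> ?Z"
    have "?N (w - w0) \<le> ?N (w - u) + ?N (w1 - u) + n"
      using normM_triangle[of A B w w0 u] normM_triangle[of A B u w0 w1] normM_minus_commute[of A B u w1]
      unfolding n_def by linarith
    then have "e * ?N (w - w0) \<le> e * (?N (w - u) + ?N (w1 - u) + d0)"
      using e(1) \<open>n \<le> d0\<close> by (intro mult_left_mono) auto
    moreover have "?N (w - u) \<le> ?N (w - w1) + ?N (w1 - u)" by (rule normM_triangle)
    moreover have "(1 - e) * d \<le> (1 - e) * ?N (w - u)"
      using e(2) d(2)[OF u] by (intro mult_left_mono) auto
    ultimately have "(1 - e) * d - e * d0 \<le> (1 + e) * ?N (w1 - u)"
      using inexact by (simp add: algebra_simps)
    then show "((1 - e) * d - e * d0) / (1 + e) \<le> ?N (w1 - u)" using e(1) by (simp add: field_simps)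
  qed
  then have "(1 - e) * d \<le> e * d0 + (1 + e) * d1" using e(1) by (simp add: field_simps)
  also have "\<dots> \<le> e * d0 + (1 + e) * (limit_rate \<kappa> lam c * d0)"
    using contraction e(1) by (intro add_left_mono mult_left_mono) auto
  finally have "d \<le> rate \<kappa> lam c e * d0" using e(2) by (simp add: rate_def field_simps)
  then show ?thesis by (simp add: d d0 lam_def)
qed

end


section \<open>Identification of the support\<close>

text \<open>Telescoping over the sweep: downward closed index sets are the initial segments visited
  so far, and adding the next index changes one coordinate and one penalty term. The empty set gives
  \<open>z\<close>, the full set \<open>z'\<close>.\<close>

lemma coordinatewise_decrease:
  fixes \<Theta> :: "real^('p::{finite,linorder}) \<Rightarrow> real" and pen :: "'p::{finite,linorder} \<Rightarrow> real \<Rightarrow> real"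
  assumes step: "\<And>i. \<Theta> (\<chi> j. if j < i then z' $ j else if j = i then z' $ i else z $ j) + pen i (z' $ i)
    \<le> \<Theta> (\<chi> j. if j < i then z' $ j else if j = i then z $ i else z $ j) + pen i (z $ i)"
  shows "\<Theta> z' + (\<Sum>i\<in>UNIV. pen i (z' $ i)) \<le> \<Theta> z + (\<Sum>i\<in>UNIV. pen i (z $ i))"
proof -
  define mix :: "'p::{finite,linorder} set \<Rightarrow> real^('p::{finite,linorder})" where "mix J = (\<chi> j. if j \<in> J then z' $ j else z $ j)" for J
  define V where "V J = \<Theta> (mix J) + (\<Sum>i\<in>UNIV. pen i (mix J $ i))" for J
  have "(\<forall>j\<in>J. \<forall>i<j. i \<in> J) \<longrightarrow> V J \<le> V {}" if "finite J" for J
    using that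
  proof (induction J rule: finite_linorder_max_induct)
    case (insert b J)
    show ?case
    proof
      assume dc: "\<forall>j\<in>insert b J. \<forall>i<j. i \<in> insert b J"
      then have J: "J = {..<b}" using insert.hyps by auto
      have 1: "mix (insert b J) = (\<chi> j. if j < b then z' $ j else if j = b then z' $ b else z $ j)"
        and 2: "mix J = (\<chi> j. if j < b then z' $ j else if j = b then z $ b else z $ j)"
        by (auto simp: mix_def J vec_eq_iff)
      have "(\<Sum>i\<in>UNIV - {b}. pen i (mix (insert b J) $ i)) = (\<Sum>i\<in>UNIV - {b}. pen i (mix J $ i))"
        by (intro sum.cong) (auto simp: mix_def)
      then have "V (insert b J) - V J
          = \<Theta> (mix (insert b J)) + pen b (z' $ b) - (\<Theta> (mix J) + pen b (z $ b))"
        by (simp add: V_def sum.remove[of UNIV b] 1 2)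
      also have "\<dots> \<le> 0" using step[of b] unfolding 1 2 by simp
      finally have "V (insert b J) \<le> V J" by simp
      moreover have "V J \<le> V {}" using insert.IH by (auto simp: J)
      ultimately show "V (insert b J) \<le> V {}" by simp
    qed
  qed simp
  from this[of UNIV] show ?thesis by (simp add: V_def mix_def)
qed

lemma eventual_value_eqI:
  assumes "\<forall>\<^sub>F k in sequentially. T k = S"
  shows "eventual_value T = S"
  unfolding eventual_value_def
proof (rule the_equality)
  fix S' assume "\<forall>\<^sub>F k in sequentially. T k = S'"
  with assms have "\<forall>\<^sub>F k in sequentially. S' = S" by eventually_elim simp
  then show "S' = S" by simp
qed (rule assms)

text \<open>The outer iteration as the support argument sees it: the sweep, the zero pattern of the
  new dual point, and the criteria (C1) and (C2).\<close>

locale ppsna_run = composite_dual f g A B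
  for f :: "real^'n \<Rightarrow> ereal" and g :: "real^'m \<Rightarrow> ereal"
    and A :: "real^'n^'m" and B :: "real^'n^('p::{finite,linorder})" +
  fixes \<mu> :: "real^('p::{finite,linorder})" and \<gamma> \<epsilon> :: "nat \<Rightarrow> real" and \<gamma>inf :: real
    and x :: "nat \<Rightarrow> real^'n" and w :: "nat \<Rightarrow> (real^'m) \<times> (real^('p::{finite,linorder}))" and zt :: "nat \<Rightarrow> real^('p::{finite,linorder})"
  assumes \<mu>: "\<And>i. \<mu> $ i > 0" and \<gamma>0: "\<gamma> 0 > 0" and mono_\<gamma>: "mono \<gamma>" and lim_\<gamma>: "\<gamma> \<longlonglongrightarrow> \<gamma>inf"
    and w0: "fst (w 0) \<in> edom (conjugate_fun g)"
    and sweep: "\<And>k. coordinate_sweep f g A B \<mu> (\<gamma> k) (w k) (zt k)"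
    and w_Suc: "\<And>k. \<forall>i\<in>-index_supp (zt k). snd (w (Suc k)) $ i = 0"
    and C1: "\<And>k. Xi_prox f g A B (\<gamma> k) (w k) (w (Suc k))
                   - Xi_prox f g A B (\<gamma> k) (w k) (fst (w k), zt k)
                 \<le> ereal (1 / (4 * \<gamma> k) * (normM A B (w (Suc k) - w k))\<^sup>2)"
    and C2: "\<And>k. duality_gap f g A B (\<gamma> k) (index_supp (zt k)) (w k) (x (Suc k)) (w (Suc k))
                 \<le> ereal ((\<epsilon> k)\<^sup>2 / (2 * \<gamma> k))"
    and \<epsilon>: "\<And>k. 0 \<le> \<epsilon> k" "summable \<epsilon>"
    and bounded_w: "bounded (range w)"
begin

section \<open>Descent of the penalized dual objective\<close>

lemma \<gamma>_ge: "\<gamma> 0 \<le> \<gamma> k"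
  using mono_\<gamma> by (simp add: monoD)

lemma \<gamma>_pos: "0 < \<gamma> k"
  using \<gamma>_ge[of k] \<gamma>0 by linarith

lemma \<gamma>_le: "\<gamma> k \<le> \<gamma>inf"
  using incseq_le[OF _ lim_\<gamma>] mono_\<gamma> by (simp add: monotone_on_def incseq_def)

lemma w_dom: "fst (w k) \<in> dom_g"
  using w0 duality_gap_finite[OF C2] by (cases k) auto

definition "penalty z = (\<Sum>i\<in>UNIV. if z $ i \<noteq> 0 then \<mu> $ i else 0)"
definition "penalized k = dual_obj (w k) + penalty (snd (w k))"
definition "wt k = (fst (w k), zt k)"

lemma penalty_nonneg: "0 \<le> penalty z"
  unfolding penalty_def by (rule sum_nonneg) (simp add: \<mu> less_imp_le)

lemma penalty_mono: "index_supp z \<subseteq> index_supp z' \<Longrightarrow> penalty z \<le> penalty z'"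
  unfolding penalty_def using \<mu> by (intro sum_mono) (auto simp: index_supp_def less_imp_le)

text \<open>The sweep at its visit to coordinate \<open>i\<close>: \<open>t = zt k $ i\<close> gives
  the state after the visit, \<open>t = snd (w k) $ i\<close> the state before it.\<close>

definition "mixed k i t = (fst (w k), \<chi> j. if j < i then zt k $ j else if j = i then t else snd (w k) $ j)"

lemma sweep_real:
  "dual_obj (mixed k i (zt k $ i)) + 1 / (2 * \<gamma> k) * (normM A B (mixed k i (zt k $ i) - w k))\<^sup>2
      + (if zt k $ i \<noteq> 0 then \<mu> $ i else 0)
    \<le> dual_obj (mixed k i t) + 1 / (2 * \<gamma> k) * (normM A B (mixed k i t - w k))\<^sup>2
      + (if t \<noteq> 0 then \<mu> $ i else 0)"
proof -
  have "Xi_prox f g A B (\<gamma> k) (w k) (mixed k i (zt k $ i)) + ereal (if zt k $ i \<noteq> 0 then \<mu> $ i else 0)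
      \<le> Xi_prox f g A B (\<gamma> k) (w k) (mixed k i t) + ereal (if t \<noteq> 0 then \<mu> $ i else 0)"
    using sweep[of k] unfolding coordinate_sweep_def is_arg_min_linorder mixed_def by blast
  then show ?thesis by (simp add: Xi_prox_eq mixed_def w_dom)
qed

text \<open>The sweep starts at \<open>w k\<close> itself, where the proximal term vanishes, so only
  the penalized value remains on the right.\<close>

lemma sweep_decrease:
  "dual_obj (wt k) + 1 / (2 * \<gamma> k) * (normM A B (wt k - w k))\<^sup>2 + penalty (zt k) \<le> penalized k"
proof -
  let ?\<Theta> = "\<lambda>z. dual_obj (fst (w k), z) + 1 / (2 * \<gamma> k) * (normM A B ((fst (w k), z) - w k))\<^sup>2"
  have "?\<Theta> (zt k) + (\<Sum>i\<in>UNIV. if zt k $ i \<noteq> 0 then \<mu> $ i else 0)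
      \<le> ?\<Theta> (snd (w k)) + (\<Sum>i\<in>UNIV. if snd (w k) $ i \<noteq> 0 then \<mu> $ i else 0)"
    by (rule coordinatewise_decrease[where pen = "\<lambda>i t. if t \<noteq> 0 then \<mu> $ i else 0"])
      (rule sweep_real[unfolded mixed_def])
  then show ?thesis by (simp add: penalized_def penalty_def wt_def normM_def)
qed

lemma C1_real:
  "dual_obj (w (Suc k)) + 1 / (4 * \<gamma> k) * (normM A B (w (Suc k) - w k))\<^sup>2
    \<le> dual_obj (wt k) + 1 / (2 * \<gamma> k) * (normM A B (wt k - w k))\<^sup>2"
proof -
  \<comment> \<open>(C1) uses up one half of the proximal term; the other half remains as guaranteed
    descent.\<close>
  have "1 / (2 * \<gamma> k) * (normM A B (w (Suc k) - w k))\<^sup>2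
      = 1 / (4 * \<gamma> k) * (normM A B (w (Suc k) - w k))\<^sup>2 + 1 / (4 * \<gamma> k) * (normM A B (w (Suc k) - w k))\<^sup>2"
    using \<gamma>_pos[of k] by (simp add: field_simps)
  then show ?thesis using C1[of k] by (simp add: Xi_prox_eq w_dom wt_def)
qed

lemma penalty_Suc: "penalty (snd (w (Suc k))) \<le> penalty (zt k)"
  by (rule penalty_mono) (use w_Suc[of k] in \<open>auto simp: index_supp_def\<close>)

lemma penalized_decrease:
  "penalized (Suc k) + 1 / (4 * \<gamma> k) * (normM A B (w (Suc k) - w k))\<^sup>2 \<le> penalized k"
  using sweep_decrease[of k] C1_real[of k] penalty_Suc[of k]
  unfolding penalized_def[of "Suc k"] by linarith

lemma penalized_diff_nonneg: "0 \<le> penalized k - penalized (Suc k)"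
proof -
  have "0 \<le> 1 / (4 * \<gamma> k) * (normM A B (w (Suc k) - w k))\<^sup>2" using \<gamma>_pos[of k] by simp
  then show ?thesis using penalized_decrease[of k] by linarith
qed

text \<open>Bounded iterates keep the affine minorant bounded below and the penalty is nonnegative,
  so the decreasing sequence \<open>penalized\<close> converges.\<close>

lemma penalized_diff_tendsto_0: "(\<lambda>k. penalized k - penalized (Suc k)) \<longlonglongrightarrow> 0"
proof -
  obtain a b where ab: "\<And>v. fst v \<in> dom_g \<Longrightarrow> a \<bullet> v + b \<le> dual_obj v"
    using dual_obj_affine_minorant by blast
  obtain W where W: "\<And>k. norm (w k) \<le> W" using bounded_w by (auto simp: bounded_iff)
  have "b - norm a * W \<le> penalized k" for k
  proof -
    have "- (a \<bullet> w k) \<le> norm a * norm (w k)" using norm_cauchy_schwarz[of "- a" "w k"] by simp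
    also have "\<dots> \<le> norm a * W" by (intro mult_left_mono W) simp
    finally show ?thesis using ab[OF w_dom, of k] penalty_nonneg[of "snd (w k)"]
      unfolding penalized_def by linarith
  qed
  moreover have "decseq penalized"
    using penalized_diff_nonneg by (intro decseq_SucI) simp
  ultimately obtain l where l: "penalized \<longlonglongrightarrow> l"
    using decseq_convergent[of penalized "b - norm a * W"] by blast
  show ?thesis using tendsto_diff[OF l LIMSEQ_Suc[OF l]] by simp
qed

lemma w_step_tendsto_0: "(\<lambda>k. norm (w (Suc k) - w k)) \<longlonglongrightarrow> 0"
proof (rule tendsto_sandwich[OF always_eventually always_eventually tendsto_const])
  show "(\<lambda>k. sqrt (4 * \<gamma>inf * (penalized k - penalized (Suc k)))) \<longlonglongrightarrow> 0"
    using tendsto_real_sqrt[OF tendsto_mult_left[OF penalized_diff_tendsto_0, of "4 * \<gamma>inf"]] by simp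
  show "\<forall>k. norm (w (Suc k) - w k) \<le> sqrt (4 * \<gamma>inf * (penalized k - penalized (Suc k)))"
  proof
    fix k
    have "(normM A B (w (Suc k) - w k))\<^sup>2 \<le> 4 * \<gamma> k * (penalized k - penalized (Suc k))"
      using penalized_decrease[of k] \<gamma>_pos[of k] by (simp add: field_simps)
    also have "\<dots> \<le> 4 * \<gamma>inf * (penalized k - penalized (Suc k))"
      using \<gamma>_le[of k] penalized_diff_nonneg[of k] by (intro mult_right_mono) auto
    finally have "normM A B (w (Suc k) - w k) \<le> sqrt (4 * \<gamma>inf * (penalized k - penalized (Suc k)))"
      by (rule real_le_rsqrt)
    then show "norm (w (Suc k) - w k) \<le> sqrt (4 * \<gamma>inf * (penalized k - penalized (Suc k)))"
      using norm_le_normM order.trans by blast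
  qed
qed auto

text \<open>Both points are compared with the exact minimizer \<open>w1\<close> over the support of
  \<open>zt k\<close>: (C2) puts \<open>w (Suc k)\<close> within \<open>\<epsilon> k\<close> of it,
  and quadratic growth bounds the distance of \<open>wt k\<close> by the decrease of
  \<open>penalized\<close> and \<open>\<epsilon> k\<close>.\<close>

lemma wt_diff_tendsto_0: "(\<lambda>k. norm (wt k - w (Suc k))) \<longlonglongrightarrow> 0"
proof (rule tendsto_sandwich[OF always_eventually always_eventually tendsto_const])
  have \<epsilon>0: "\<epsilon> \<longlonglongrightarrow> 0" using \<epsilon>(2) by (rule summable_LIMSEQ_zero)
  have "(\<lambda>k. sqrt (2 * \<gamma>inf * (penalized k - penalized (Suc k)) + (\<epsilon> k)\<^sup>2) + \<epsilon> k)
      \<longlonglongrightarrow> sqrt (2 * \<gamma>inf * 0 + 0\<^sup>2) + 0"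
    by (intro tendsto_intros penalized_diff_tendsto_0 \<epsilon>0)
  then show "(\<lambda>k. sqrt (2 * \<gamma>inf * (penalized k - penalized (Suc k)) + (\<epsilon> k)\<^sup>2) + \<epsilon> k) \<longlonglongrightarrow> 0"
    by simp
  show "\<forall>k. norm (wt k - w (Suc k))
      \<le> sqrt (2 * \<gamma>inf * (penalized k - penalized (Suc k)) + (\<epsilon> k)\<^sup>2) + \<epsilon> k"
  proof
    fix k
    obtain w1 where w1: "- (1 / \<gamma> k) *\<^sub>R M_map A B (w1 - w k) \<in> S_map f g A B (index_supp (zt k)) w1"
      using S_map_prox_point[OF \<gamma>_pos[of k]] by blast
    note gap = dist_prox_point_le_gap[OF \<gamma>_pos w1 C2 w_Suc]
    have "normM A B (w (Suc k) - w1) \<le> \<epsilon> k" by (rule power2_le_imp_le[OF gap(1) \<epsilon>(1)])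
    moreover have "normM A B (wt k - w1) \<le> sqrt (2 * \<gamma>inf * (penalized k - penalized (Suc k)) + (\<epsilon> k)\<^sup>2)"
    proof (rule real_le_rsqrt)
      have "wt k \<in> feasible (index_supp (zt k))"
        by (simp add: feasible_def wt_def w_dom index_supp_def)
      note growth = prox_point_quadratic_growth[OF w1 this]
      have "1 / (4 * \<gamma> k) * (normM A B (w (Suc k) - w k))\<^sup>2 \<ge> 0"
        "1 / (2 * \<gamma> k) * (normM A B (w (Suc k) - w k))\<^sup>2 \<ge> 0" using \<gamma>_pos[of k] by auto
      then have "1 / (2 * \<gamma> k) * (normM A B (wt k - w1))\<^sup>2
          \<le> penalized k - penalized (Suc k) + (\<epsilon> k)\<^sup>2 / (2 * \<gamma> k)"
        using growth gap(2) sweep_decrease[of k] penalty_Suc[of k]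
        unfolding penalized_def[of "Suc k"] by linarith
      then have "(normM A B (wt k - w1))\<^sup>2 \<le> 2 * \<gamma> k * (penalized k - penalized (Suc k)) + (\<epsilon> k)\<^sup>2"
        using \<gamma>_pos[of k] by (simp add: field_simps)
      also have "2 * \<gamma> k * (penalized k - penalized (Suc k)) \<le> 2 * \<gamma>inf * (penalized k - penalized (Suc k))"
        using \<gamma>_le[of k] penalized_diff_nonneg[of k] by (intro mult_right_mono) auto
      finally show "(normM A B (wt k - w1))\<^sup>2
          \<le> 2 * \<gamma>inf * (penalized k - penalized (Suc k)) + (\<epsilon> k)\<^sup>2" by simp
    qed
    ultimately have "normM A B (wt k - w (Suc k))
        \<le> sqrt (2 * \<gamma>inf * (penalized k - penalized (Suc k)) + (\<epsilon> k)\<^sup>2) + \<epsilon> k"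
      using normM_triangle[of A B "wt k" "w (Suc k)" w1] normM_minus_commute[of A B w1 "w (Suc k)"]
      by linarith
    then show "norm (wt k - w (Suc k))
        \<le> sqrt (2 * \<gamma>inf * (penalized k - penalized (Suc k)) + (\<epsilon> k)\<^sup>2) + \<epsilon> k"
      using norm_le_normM order.trans by blast
  qed
qed auto

section \<open>Stabilization of the supports\<close>

lemma wt_bounded:
  obtains R where "\<And>k. norm (w k) \<le> R" and "\<And>k. norm (wt k) \<le> R"
proof -
  obtain W where W: "\<And>k. norm (w k) \<le> W" using bounded_w by (auto simp: bounded_iff)
  have "Bseq (\<lambda>k. norm (wt k - w (Suc k)))"
    using wt_diff_tendsto_0 convergentI convergent_imp_Bseq by blast
  then obtain D where D: "\<And>k. norm (wt k - w (Suc k)) \<le> D" by (auto simp: Bseq_def)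
  have "D \<ge> 0" using D[of 0] norm_ge_zero order.trans by blast
  moreover have "norm (wt k) \<le> W + D" for k
    using norm_triangle_ineq[of "wt k - w (Suc k)" "w (Suc k)"] W[of "Suc k"] D[of k] by simp
  ultimately show thesis using W that[of "W + D"] by (meson add_increasing2 order.trans order.refl)
qed

lemma nonzero_coordinates_bounded_away:
  obtains \<delta> where "\<delta> > 0" and "\<And>k i. zt k $ i \<noteq> 0 \<Longrightarrow> \<delta> \<le> \<bar>zt k $ i\<bar>"
proof -
  obtain R where R: "\<And>k. norm (w k) \<le> R" "\<And>k. norm (wt k) \<le> R" using wt_bounded by blast
  \<comment> \<open>Points \<open>mixed k i t\<close> with \<open>t\<close> either 0 or
    \<open>zt k $ i\<close> are assembled from pieces of \<open>wt k\<close> and \<open>w k\<close>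
    and have norm at most \<open>3 * R\<close>; subtracting \<open>w k\<close> adds one more
    \<open>R\<close>.\<close>
  define D where "D = cball (0 :: (real^'m) \<times> (real^('p::{finite,linorder}))) (4 * R)"
  define m where "m = Min (range (\<lambda>i. \<mu> $ i))"
  have m: "0 < m" "\<And>i. m \<le> \<mu> $ i" using \<mu> by (auto simp: m_def)
  have "uniformly_continuous_on D (\<lambda>v. fconj (- Qt v))"
    using compact_uniformly_continuous[OF continuous_fconj_Qt] by (simp add: D_def)
  then obtain \<delta>1 where \<delta>1: "\<delta>1 > 0" "\<And>u v. u \<in> D \<Longrightarrow> v \<in> D \<Longrightarrow> norm (u - v) < \<delta>1
      \<Longrightarrow> \<bar>fconj (- Qt u) - fconj (- Qt v)\<bar> < m / 2"
    unfolding uniformly_continuous_on_def dist_norm real_norm_def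
    using half_gt_zero[OF m(1)] by metis
  have "continuous_on D (\<lambda>v. (normM A B v)\<^sup>2)"
    unfolding normM_eq[abs_def]
    by (intro continuous_on_power continuous_on_norm linear_continuous_on
        linear_K_map[THEN linear_conv_bounded_linear[THEN iffD1]])
  then have "uniformly_continuous_on D (\<lambda>v. (normM A B v)\<^sup>2)"
    by (rule compact_uniformly_continuous) (simp add: D_def)
  \<comment> \<open>Since \<open>\<gamma> 0 \<le> \<gamma> k\<close>, division by
    \<open>2 * \<gamma> k\<close> turns this tolerance into \<open>m / 2\<close>, so that both
    changes together stay below \<open>m\<close>.\<close>
  then obtain \<delta>2 where \<delta>2: "\<delta>2 > 0" "\<And>u v. u \<in> D \<Longrightarrow> v \<in> D \<Longrightarrow> norm (u - v) < \<delta>2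
      \<Longrightarrow> \<bar>(normM A B u)\<^sup>2 - (normM A B v)\<^sup>2\<bar> < \<gamma> 0 * m"
    unfolding uniformly_continuous_on_def dist_norm real_norm_def
    using mult_pos_pos[OF \<gamma>0 m(1)] by metis
  show thesis
  proof
    show "min \<delta>1 \<delta>2 > 0" using \<delta>1 \<delta>2 by simp
    fix k i assume nz: "zt k $ i \<noteq> 0"
    show "min \<delta>1 \<delta>2 \<le> \<bar>zt k $ i\<bar>"
    proof (rule ccontr)
      assume small: "\<not> ?thesis"
      let ?p = "mixed k i (zt k $ i)" and ?q = "mixed k i 0"
      have bound: "norm (fst (w k), vec_part J (zt k) + vec_part J' (snd (w k))) \<le> 3 * R" for J J'
      proof -
        have "norm (fst (w k), vec_part J (zt k) + vec_part J' (snd (w k)))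
            \<le> norm (fst (w k)) + (norm (vec_part J (zt k)) + norm (vec_part J' (snd (w k))))"
          by (rule order.trans[OF norm_Pair_le add_left_mono[OF norm_triangle_ineq]])
        also have "\<dots> \<le> R + (R + R)"
        proof (intro add_mono)
          show "norm (fst (w k)) \<le> R" using norm_fst_le[of "fst (w k)" "snd (w k)"] R(1)[of k] by simp
          show "norm (vec_part J (zt k)) \<le> R"
            using norm_vec_part_le[of J "zt k"] norm_snd_le[of "zt k" "fst (w k)"] R(2)[of k]
            by (simp add: wt_def)
          show "norm (vec_part J' (snd (w k))) \<le> R"
            using norm_vec_part_le[of J' "snd (w k)"] norm_snd_le[of "snd (w k)" "fst (w k)"] R(1)[of k] by simp
        qed
        finally show ?thesis by simp
      qed
      have "?p = (fst (w k), vec_part {..i} (zt k) + vec_part {i<..} (snd (w k)))"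
        "?q = (fst (w k), vec_part {..<i} (zt k) + vec_part {i<..} (snd (w k)))"
        by (auto simp: mixed_def vec_part_def vec_eq_iff)
      then have pq: "norm ?p \<le> 3 * R" "norm ?q \<le> 3 * R" using bound by simp_all
      moreover have "R \<ge> 0" using R(1)[of 0] norm_ge_zero order.trans by blast
      ultimately have D: "?p \<in> D" "?q \<in> D" "?p - w k \<in> D" "?q - w k \<in> D"
        using norm_triangle_ineq4[of ?p "w k"] norm_triangle_ineq4[of ?q "w k"] R(1)[of k]
        by (auto simp: D_def)
      have "?p - ?q = (0, axis i (zt k $ i))"
        by (auto simp: mixed_def vec_eq_iff axis_def)
      then have "norm (?p - ?q) = \<bar>zt k $ i\<bar>"
        by (simp add: norm_Pair norm_eq_sqrt_inner[of "axis _ _"] inner_axis_axis)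
      then have n: "norm (?p - ?q) < \<delta>1" "norm ((?p - w k) - (?q - w k)) < \<delta>2" using small by auto
      have "\<bar>(normM A B (?p - w k))\<^sup>2 - (normM A B (?q - w k))\<^sup>2\<bar> < \<gamma> k * m"
        using \<delta>2(2)[OF D(3,4) n(2)] mult_right_mono[OF \<gamma>_ge[of k], of m] m(1) by linarith
      then have "1 / (2 * \<gamma> k) * (normM A B (?q - w k))\<^sup>2 - 1 / (2 * \<gamma> k) * (normM A B (?p - w k))\<^sup>2 < m / 2"
        using \<gamma>_pos[of k] by (simp add: field_simps)
      moreover have "dual_obj ?q - dual_obj ?p < m / 2"
      proof -
        have "dual_obj ?q - dual_obj ?p = fconj (- Qt ?q) - fconj (- Qt ?p)"
          by (simp add: dual_obj_def mixed_def)
        with \<delta>1(2)[OF D(1,2) n(1)] show ?thesis by linarith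
      qed
      \<comment> \<open>Resetting coordinate \<open>i\<close> to 0 leaves \<open>gconj\<close>
        unchanged, raises the other smooth and proximal terms by less than \<open>m\<close> and
        saves \<open>\<mu> $ i\<close>, which is at least \<open>m\<close>; this contradicts the
        sweep.\<close>
      ultimately show False using sweep_real[of k i 0] nz m(2)[of i] by simp
    qed
  qed
qed

text \<open>The way from \<open>wt k\<close> to \<open>wt (Suc k)\<close> through two consecutive
  iterates has three legs, each eventually below \<open>\<delta> / 3\<close>. No coordinate can then
  switch between 0 and modulus at least \<delta>.\<close>

lemma index_supp_eventually_constant:
  "\<exists>S. \<forall>\<^sub>F k in sequentially. index_supp (zt k) = S"
proof -
  obtain \<delta> where \<delta>: "\<delta> > 0" "\<And>k i. zt k $ i \<noteq> 0 \<Longrightarrow> \<delta> \<le> \<bar>zt k $ i\<bar>"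
    using nonzero_coordinates_bounded_away by blast
  have e: "\<forall>\<^sub>F k in sequentially. a k < \<delta> / 3" if "a \<longlonglongrightarrow> 0" for a :: "nat \<Rightarrow> real"
    using order_tendstoD(2)[OF that, of "\<delta> / 3"] \<delta>(1) by simp
  have "\<forall>\<^sub>F k in sequentially. index_supp (zt (Suc k)) = index_supp (zt k)"
    using e[OF wt_diff_tendsto_0] e[OF LIMSEQ_Suc[OF wt_diff_tendsto_0]] e[OF LIMSEQ_Suc[OF w_step_tendsto_0]]
  proof eventually_elim
    case (elim k)
    have "norm (wt k - wt (Suc k)) \<le> norm (wt k - w (Suc k)) + norm (w (Suc (Suc k)) - w (Suc k))
        + norm (wt (Suc k) - w (Suc (Suc k)))"
      by norm
    with elim have "norm (wt k - wt (Suc k)) < \<delta>" by linarith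
    then have "\<bar>zt k $ i - zt (Suc k) $ i\<bar> < \<delta>" for i
      using component_le_norm_cart[of "zt k - zt (Suc k)" i]
        norm_snd_le[of "zt k - zt (Suc k)" "fst (w k) - fst (w (Suc k))"]
      by (simp add: wt_def)
    then have "zt k $ i = 0 \<longleftrightarrow> zt (Suc k) $ i = 0" for i
      using \<delta>(2)[of k i] \<delta>(2)[of "Suc k" i] by (metis abs_minus_commute diff_0_right diff_zero not_le)
    then show ?case by (simp add: index_supp_def)
  qed
  then obtain N where N: "\<And>k. k \<ge> N \<Longrightarrow> index_supp (zt (Suc k)) = index_supp (zt k)"
    by (auto simp: eventually_sequentially)
  have "index_supp (zt k) = index_supp (zt N)" if "k \<ge> N" for k
    using that by (induction rule: dec_induct) (auto simp: N)
  then show ?thesis by (auto simp: eventually_sequentially)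
qed

end


section \<open>The convergence rate\<close>

lemma limit_rate_bounds:
  assumes "0 < \<kappa>" and "0 < lam" and "0 < c"
  shows "0 < limit_rate \<kappa> lam c" and "limit_rate \<kappa> lam c < 1"
proof -
  have "sqrt ((\<kappa> * lam)\<^sup>2) < sqrt (c\<^sup>2 + \<kappa>\<^sup>2 * lam\<^sup>2)"
    using assms by (simp add: power_mult_distrib)
  moreover have "0 < \<kappa> * lam" using assms by simp
  ultimately have "0 < \<kappa> * lam" "\<kappa> * lam < sqrt (c\<^sup>2 + \<kappa>\<^sup>2 * lam\<^sup>2)" by auto
  moreover from this have "0 < sqrt (c\<^sup>2 + \<kappa>\<^sup>2 * lam\<^sup>2)" by linarith
  ultimately show "0 < limit_rate \<kappa> lam c" "limit_rate \<kappa> lam c < 1"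
    unfolding limit_rate_def by (simp_all only: divide_pos_pos divide_less_eq_1_pos)
qed

text \<open>Strict positivity makes the rate times \<infinity> equal to \<infinity>, whereas
  \<open>0 * \<infinity> = 0\<close> in \<open>ereal\<close>; this matters when there are no
  zeros.\<close>

lemma rate_pos:
  assumes "0 < \<kappa>" and "0 < lam" and "0 < c" and "0 \<le> e" and "e < 1"
  shows "0 < rate \<kappa> lam c e"
proof -
  have "0 < (1 + e) * limit_rate \<kappa> lam c"
    using assms limit_rate_bounds(1)[of \<kappa> lam c] by (intro mult_pos_pos) auto
  then have "0 < e + (1 + e) * limit_rate \<kappa> lam c" using assms by linarith
  moreover have "0 < inverse (1 - e)" using assms by simp
  ultimately show ?thesis unfolding rate_def by (rule mult_pos_pos[rotated])
qed

lemma rate_tendsto: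
  assumes "0 < \<kappa>" and "0 < lam" and "\<gamma> \<longlonglongrightarrow> c" and "\<eta> \<longlonglongrightarrow> 0"
  shows "(\<lambda>k. rate \<kappa> lam (\<gamma> k) (\<eta> k)) \<longlonglongrightarrow> limit_rate \<kappa> lam c"
proof -
  have "0 < \<kappa>\<^sup>2 * lam\<^sup>2" using assms by simp
  then have "c\<^sup>2 + \<kappa>\<^sup>2 * lam\<^sup>2 > 0" by (simp add: add_nonneg_pos)
  then have "(\<lambda>k. rate \<kappa> lam (\<gamma> k) (\<eta> k)) \<longlonglongrightarrow> inverse (1 - 0) * (0 + (1 + 0) * limit_rate \<kappa> lam c)"
    unfolding rate_def limit_rate_def by (intro tendsto_intros assms) auto
  then show ?thesis by simp
qed

theorem theorem11:
  fixes f :: "real^'n \<Rightarrow> ereal" and g :: "real^'m \<Rightarrow> ereal"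
    and A :: "real^'n^'m" and B :: "real^'n^('p::{finite,linorder})"
    and \<mu> :: "real^('p::{finite,linorder})"
    and \<gamma> :: "nat \<Rightarrow> real" and \<gamma>inf :: real
    and \<tau> \<tau>1 \<tau>2 \<beta> \<zeta> :: real
    and x :: "nat \<Rightarrow> real^'n" and w :: "nat \<Rightarrow> (real^'m) \<times> (real^('p::{finite,linorder}))"
    and zt :: "nat \<Rightarrow> real^('p::{finite,linorder})"
    and \<epsilon> \<eta> :: "nat \<Rightarrow> real"
    and T :: "nat \<Rightarrow> ('p::{finite,linorder}) set" and Tinf :: "('p::{finite,linorder}) set"
    and lam :: real
  defines "T \<equiv> (\<lambda>k. index_supp (zt k))"
    and "Tinf \<equiv> eventual_value T"
    and "lam \<equiv> max_eigenvalue (M_map A B)"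
  assumes "proper_closed_convex f" and "proper_closed_convex g"
    and "\<And>i. \<mu> $ i > 0"
    and "\<gamma> 0 > 0" and "mono \<gamma>" and "\<gamma> \<longlonglongrightarrow> \<gamma>inf"
    and "0 < \<tau>" and "\<tau> \<le> 1" and "0 < \<tau>1" and "\<tau>1 < 1" and "0 < \<tau>2" and "\<tau>2 < 1"
    and "0 < \<beta>" and "\<beta> < 1" and "0 < \<zeta>" and "\<zeta> < 1 / 2"
    and "ppsna_sequence f g A B \<mu> \<gamma> \<tau> \<tau>1 \<tau>2 \<beta> \<zeta> x w zt"
    and C1: "\<And>k. Xi_prox f g A B (\<gamma> k) (w k) (w (Suc k))
                   - Xi_prox f g A B (\<gamma> k) (w k) (fst (w k), zt k)
                 \<le> ereal (1 / (4 * \<gamma> k) * (normM A B (w (Suc k) - w k))\<^sup>2)"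
    and C2: "\<And>k. duality_gap f g A B (\<gamma> k) (T k) (w k) (x (Suc k)) (w (Suc k))
                 \<le> ereal ((\<epsilon> k)\<^sup>2 / (2 * \<gamma> k))"
    and "\<And>k. 0 \<le> \<epsilon> k" and "summable \<epsilon>"
    and C3: "\<And>k. duality_gap f g A B (\<gamma> k) (T k) (w k) (x (Suc k)) (w (Suc k))
                 \<le> ereal ((\<eta> k)\<^sup>2 / (2 * \<gamma> k) * (normM A B (w (Suc k) - w k))\<^sup>2)"
    and "\<And>k. 0 \<le> \<eta> k" and "\<And>k. \<eta> k < 1" and "summable \<eta>"
    and "Liminf at_infinity (\<lambda>v. f v / ereal (norm v)) = \<infinity>"
    and "bounded (range w)"
    and "continuous_on (edom (conjugate_fun g)) (conjugate_fun g)"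
    and "{v. v \<in> ri_edom f \<and> A *v v \<in> ri_edom g \<and> (\<forall>i\<in>Tinf. (B *v v) $ i = 0)} \<noteq> {}"
    and "\<And>\<nu>1. \<nu>1 > 0 \<Longrightarrow>
           \<exists>\<zeta>1>0. error_bound (S_map f g A B Tinf) (S_zeros f g A B Tinf) \<nu>1 \<zeta>1"
  shows "\<exists>\<nu>1>0. \<exists>\<zeta>1>0.
           error_bound (S_map f g A B Tinf) (S_zeros f g A B Tinf) \<nu>1 \<zeta>1 \<and>
           (\<forall>\<^sub>F k in sequentially.
              distM_set A B (w (Suc k)) (S_zeros f g A B Tinf)
                \<le> ereal (rate \<zeta>1 lam (\<gamma> k) (\<eta> k)) * distM_set A B (w k) (S_zeros f g A B Tinf)) \<and>
           limsup (\<lambda>k. ereal (rate \<zeta>1 lam (\<gamma> k) (\<eta> k))) = ereal (limit_rate \<zeta>1 lam \<gamma>inf) \<and>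
           limit_rate \<zeta>1 lam \<gamma>inf < 1"
proof -
  have seq: "fst (w 0) \<in> edom (conjugate_fun g)"
    "\<And>k. coordinate_sweep f g A B \<mu> (\<gamma> k) (w k) (zt k)"
    "\<And>k. \<exists>v. w (Suc k) = sna_dual g A B (\<gamma> k) (index_supp (zt k)) (w k) v"
    using \<open>ppsna_sequence f g A B \<mu> \<gamma> \<tau> \<tau>1 \<tau>2 \<beta> \<zeta> x w zt\<close> unfolding ppsna_sequence_def by blast+
  have w_Suc: "\<forall>i\<in>-index_supp (zt k). snd (w (Suc k)) $ i = 0" for k
    using seq(3)[of k] by (auto simp: sna_dual_def vec_part_def)
  have f: "\<And>v. f v \<noteq> -\<infinity>" "closed (epi f)"
    using \<open>proper_closed_convex f\<close> by (auto simp: proper_closed_convex_def)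
  interpret ppsna_run f g A B \<mu> \<gamma> \<epsilon> \<gamma>inf x w zt
  proof unfold_locales
    show "edom (conjugate_fun f) = UNIV"
      by (rule edom_conjugate_fun_coercive) fact+
    show "edom (conjugate_fun g) \<noteq> {}" using seq(1) by auto
    show "fst (w 0) \<in> edom (conjugate_fun g)" by (rule seq(1))
    show "coordinate_sweep f g A B \<mu> (\<gamma> k) (w k) (zt k)" for k by (rule seq(2))
    show "\<forall>i\<in>-index_supp (zt k). snd (w (Suc k)) $ i = 0" for k by (rule w_Suc)
    show "duality_gap f g A B (\<gamma> k) (index_supp (zt k)) (w k) (x (Suc k)) (w (Suc k))
      \<le> ereal ((\<epsilon> k)\<^sup>2 / (2 * \<gamma> k))" for k using C2 by (simp add: T_def)
  qed fact+
  obtain S where S: "\<forall>\<^sub>F k in sequentially. T k = S"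
    using index_supp_eventually_constant unfolding T_def by blast
  then have T_eq: "\<forall>\<^sub>F k in sequentially. T k = Tinf"
    using eventual_value_eqI[OF S] by (simp add: Tinf_def)
  let ?Z = "S_zeros f g A B Tinf"
  have lam1: "1 \<le> lam" unfolding lam_def by (rule max_eigenvalue_M_map)
  have \<gamma>inf: "0 < \<gamma>inf" using \<gamma>0 \<gamma>_le[of 0] by linarith
  have \<eta>0: "\<eta> \<longlonglongrightarrow> 0" using \<open>summable \<eta>\<close> by (rule summable_LIMSEQ_zero)
  have limits: "limsup (\<lambda>k. ereal (rate \<kappa> lam (\<gamma> k) (\<eta> k))) = ereal (limit_rate \<kappa> lam \<gamma>inf)"
    "limit_rate \<kappa> lam \<gamma>inf < 1" if "\<kappa> > 0" for \<kappa>
    using rate_tendsto[OF that _ lim_\<gamma> \<eta>0, of lam] limit_rate_bounds(2)[OF that _ \<gamma>inf, of lam] lam1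
    by (auto intro: lim_imp_Limsup)
  show ?thesis
  proof (cases "?Z = {}")
    case True
    \<comment> \<open>\<open>assms(33)\<close> is the error bound hypothesis (4). Both distances are
      infinite here, so any radius will do.\<close>
    obtain \<kappa> where \<kappa>: "\<kappa> > 0" "error_bound (S_map f g A B Tinf) ?Z 1 \<kappa>"
      using assms(33)[of 1] by auto
    have step: "distM_set A B (w (Suc k)) ?Z
        \<le> ereal (rate \<kappa> lam (\<gamma> k) (\<eta> k)) * distM_set A B (w k) ?Z" for k
      using rate_pos[OF \<kappa>(1) _ \<gamma>_pos[of k], of lam "\<eta> k"] lam1 \<open>0 \<le> \<eta> k\<close> \<open>\<eta> k < 1\<close>
      by (simp add: True distM_set_def top_ereal_def)
    show ?thesis
      by (intro exI[of _ 1] exI[of _ \<kappa>] conjI always_eventually allI zero_less_one \<kappa> limits step)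
  next
    case False
    then obtain u0 where u0: "u0 \<in> ?Z" by auto
    obtain W where W: "\<And>k. norm (w k) \<le> W" using bounded_w by (auto simp: bounded_iff)
    \<comment> \<open>This radius bounds the M-distance of every iterate from the fixed zero
      \<open>u0\<close>, so one error bound constant serves all \<open>k\<close>; the summand 1
      makes it positive.\<close>
    define \<nu> where "\<nu> = 1 + sqrt lam * (W + norm u0)"
    have near: "normM A B (w k - u0) \<le> \<nu>" for k
    proof -
      have "normM A B (w k - u0) \<le> sqrt lam * norm (w k - u0)"
        using real_le_rsqrt[OF max_eigenvalue_M_map(2)[of A B "w k - u0"]]
        by (simp add: real_sqrt_mult lam_def)
      also have "\<dots> \<le> sqrt lam * (W + norm u0)"
        using lam1 W[of k] norm_triangle_ineq4[of "w k" u0] by (intro mult_left_mono) auto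
      finally show ?thesis by (simp add: \<nu>_def)
    qed
    have "\<nu> > 0"
    proof -
      have "0 \<le> W + norm u0" using W[of 0] by (meson add_nonneg_nonneg norm_ge_zero order.trans)
      then have "0 \<le> sqrt lam * (W + norm u0)" using lam1 by simp
      then show ?thesis by (simp add: \<nu>_def)
    qed
    then obtain \<kappa> where \<kappa>: "\<kappa> > 0" "error_bound (S_map f g A B Tinf) ?Z \<nu> \<kappa>"
      using assms(33) by blast
    have step: "\<forall>\<^sub>F k in sequentially. distM_set A B (w (Suc k)) ?Z
        \<le> ereal (rate \<kappa> lam (\<gamma> k) (\<eta> k)) * distM_set A B (w k) ?Z"
      using T_eq
    proof eventually_elim
      case (elim k)
      have "duality_gap f g A B (\<gamma> k) Tinf (w k) (x (Suc k)) (w (Suc k))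
          \<le> ereal ((\<eta> k)\<^sup>2 / (2 * \<gamma> k) * (normM A B (w (Suc k) - w k))\<^sup>2)"
        using C3[of k] elim by simp
      moreover have "\<forall>i\<in>-Tinf. snd (w (Suc k)) $ i = 0" using w_Suc[of k] elim by (simp add: T_def)
      ultimately show ?case
        unfolding lam_def
        by (intro inexact_prox_step_rate[OF \<gamma>_pos \<kappa>(1) \<open>0 \<le> \<eta> k\<close> \<open>\<eta> k < 1\<close> _ _ \<kappa>(2) u0 near])
    qed
    show ?thesis
      by (intro exI[of _ \<nu>] exI[of _ \<kappa>] conjI \<open>\<nu> > 0\<close> \<kappa> limits step)
  qed
qed

end
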